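(* Let $\mathcal{G}$ be a finite abelian group with the group of characters $\mathcal{G}^*={\rm Hom}(\mathcal{G},\mathbb{C}^* )$, let $G$ be a subgroup of $\mathcal{G}$ and let $\widetilde G=\{\alpha\in\mathcal{G}^*:\alpha(g)=1\text{ for all }g\in G\}$ be the dual subgroup of $\mathcal{G}^*$. Then $$\chi^{\rm orb}\circ{\rm Red}^{\mathcal{G}}_{G}=\chi^{\rm orb}\circ{\rm Red}^{\mathcal{G}^*}_{\widetilde G}\circ D_{\mathcal{G}}$$ as group homomorphisms from the Burnside ring $A(\mathcal{G})$ to $\mathbb{Z}$.
   Context: The Burnside ring $A(H)$ of a finite group $H$ is the Grothendieck ring of finite $H$-sets; as an abelian group it is freely generated by the classes $[H/K]$ for representatives $K$ of the conjugacy classes of subgroups of $H$. For a subgroup $H$ of a finite group $G'$, the reduction homomorphism ${\rm Red}^{G'}_{H}:A(G')\to A(H)$ is induced by regarding a finite $G'$-set as an $H$-set by restricting the action. For a finite abelian group $H$ with character group $H^*={\rm Hom}(H,\mathbb{C}^* )$ and a subgroup $K\subset H$, the dual subgroup is $\widetilde K=\{\alpha\in H^*:\alpha(g)=1\text{ for all }g\in K\}$. The equivariant Saito duality is the group homomorphism $D_H:A(H)\to A(H^* )$ defined on generators by $D_H([H/K])=[H^*/\widetilde K]$. For a finite group $H$ acting on a finite set $X$, the orbifold Euler characteristic is $\chi^{\rm orb}(X,H)=\frac{1}{|H|}\sum_{(g,h)\in H^2:\,gh=hg}|X^{\langle g,h\rangle}|$, where $\langle g,h\rangle$ is the subgroup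 generated by $g$ and $h$ and $X^K$ is the set of points fixed by all elements of $K$. It extends to a homomorphism of abelian groups $\chi^{\rm orb}:A(H)\to\mathbb{Z}$. *)

theory Defs
  imports Complex_Main "HOL-Algebra.Group_Action" "HOL-Algebra.Left_Coset"
    "HOL-Algebra.Elementary_Groups" "HOL-Algebra.Ring"
begin

text \<open>A set with an action of a group is a pair of its underlying set and the action map, as in
  the library's locale \<^locale>\<open>group_action\<close> (where the permutation belonging to a group element is
  extensional on the underlying set).\<close>

type_synonym ('g, 'x) gset = "'x set \<times> ('g \<Rightarrow> 'x \<Rightarrow> 'x)"

definition finite_gset :: "('g, 'm) monoid_scheme \<Rightarrow> ('g, 'x) gset \<Rightarrow> bool" where
  "finite_gset H S \<longleftrightarrow> finite (fst S) \<and> group_action H (fst S) (snd S)"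

definition gset_isomorphic ::
    "('g, 'm) monoid_scheme \<Rightarrow> ('g, 'x) gset \<Rightarrow> ('g, 'y) gset \<Rightarrow> bool" where
  "gset_isomorphic H S T \<longleftrightarrow>
     (\<exists>f. bij_betw f (fst S) (fst T) \<and>
          (\<forall>g\<in>carrier H. \<forall>x\<in>fst S. f (snd S g x) = snd T g (f x)))"

definition gset_empty :: "('g, 'x) gset" where
  "gset_empty = ({}, \<lambda>g. \<lambda>x\<in>{}. x)"

definition gset_point :: "('g, nat) gset" where
  "gset_point = ({0}, \<lambda>g. \<lambda>x\<in>{0}. x)"

definition gset_sum :: "('g, 'x) gset \<Rightarrow> ('g, 'y) gset \<Rightarrow> ('g, 'x + 'y) gset" where
  "gset_sum S T =
     (fst S <+> fst T, \<lambda>g. restrict (map_sum (snd S g) (snd T g)) (fst S <+> fst T))"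

definition gset_prod :: "('g, 'x) gset \<Rightarrow> ('g, 'y) gset \<Rightarrow> ('g, 'x \<times> 'y) gset" where
  "gset_prod S T =
     (fst S \<times> fst T, \<lambda>g. restrict (map_prod (snd S g) (snd T g)) (fst S \<times> fst T))"

definition gset_cosets :: "('g, 'm) monoid_scheme \<Rightarrow> 'g set \<Rightarrow> ('g, 'g set) gset" where
  "gset_cosets H K = (lcosets\<^bsub>H\<^esub> K, \<lambda>g. \<lambda>C\<in>lcosets\<^bsub>H\<^esub> K. g <#\<^bsub>H\<^esub> C)"

text \<open>The Burnside ring is the Grothendieck ring of the semiring of isomorphism classes of finite
  sets with an action of the group. Since every finite set is in bijection with a set of natural
  numbers, it is enough to use formal differences of such sets carried by natural numbers.
  \<open>burnside_diff H S T\<close> is the element \<open>[S] - [T]\<close>, represented by the set of all pairs \<open>(U, V)\<close> over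
  the natural numbers with \<open>[U] - [V] = [S] - [T]\<close>; here \<open>S\<close> and \<open>T\<close> may live on arbitrary types.\<close>

definition burnside_diff ::
    "('g, 'm) monoid_scheme \<Rightarrow> ('g, 'x) gset \<Rightarrow> ('g, 'y) gset
      \<Rightarrow> (('g, nat) gset \<times> ('g, nat) gset) set" where
  "burnside_diff H S T =
     {(U, V). finite_gset H U \<and> finite_gset H V \<and>
        (\<exists>Z :: ('g, nat) gset. finite_gset H Z \<and>
           gset_isomorphic H (gset_sum (gset_sum S V) Z) (gset_sum (gset_sum U T) Z))}"

definition burnside_class ::
    "('g, 'm) monoid_scheme \<Rightarrow> ('g, 'x) gset \<Rightarrow> (('g, nat) gset \<times> ('g, nat) gset) set" where
  "burnside_class H S = burnside_diff H S (gset_empty :: ('g, nat) gset)"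

definition burnside_ring ::
    "('g, 'm) monoid_scheme \<Rightarrow> (('g, nat) gset \<times> ('g, nat) gset) set ring" where
  "burnside_ring H =
     \<lparr>carrier = {burnside_diff H S T | (S :: ('g, nat) gset) (T :: ('g, nat) gset).
                   finite_gset H S \<and> finite_gset H T},
      mult = (\<lambda>a b. \<Union>(S, T)\<in>a. \<Union>(S', T')\<in>b.
                burnside_diff H (gset_sum (gset_prod S S') (gset_prod T T'))
                                (gset_sum (gset_prod S T') (gset_prod T S'))),
      one = burnside_class H (gset_point :: ('g, nat) gset),
      zero = burnside_class H (gset_empty :: ('g, nat) gset),
      add = (\<lambda>a b. \<Union>(S, T)\<in>a. \<Union>(S', T')\<in>b.
                burnside_diff H (gset_sum S S') (gset_sum T T'))\<rparr>"

text \<open>The reduction homomorphism to a subgroup \<open>K\<close>. The pair describing a set with an action is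
  not changed by it, as the action is only looked at on the carrier of the group.\<close>

definition burnside_red ::
    "('g, 'm) monoid_scheme \<Rightarrow> 'g set
      \<Rightarrow> (('g, nat) gset \<times> ('g, nat) gset) set \<Rightarrow> (('g, nat) gset \<times> ('g, nat) gset) set" where
  "burnside_red H K a = (\<Union>(S, T)\<in>a. burnside_diff (H\<lparr>carrier := K\<rparr>) S T)"

definition gset_fixed :: "('g, 'x) gset \<Rightarrow> 'g set \<Rightarrow> 'x set" where
  "gset_fixed S K = {x \<in> fst S. \<forall>k\<in>K. snd S k x = x}"

definition gset_orb_euler :: "('g, 'm) monoid_scheme \<Rightarrow> ('g, 'x) gset \<Rightarrow> rat" where
  "gset_orb_euler H S =
     1 / of_nat (order H) *
     (\<Sum>(g, h) \<in> {(g, h). g \<in> carrier H \<and> h \<in> carrier H \<and> g \<otimes>\<^bsub>H\<^esub> h = h \<otimes>\<^bsub>H\<^esub> g}.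
        of_nat (card (gset_fixed S (generate H {g, h}))))"

text \<open>The extension to the Burnside ring sends \<open>[S] - [T]\<close> to the difference of the rational numbers
  above; that this difference is an integer and does not depend on the representing pair is what
  makes the description below proper.\<close>

definition orb_euler ::
    "('g, 'm) monoid_scheme \<Rightarrow> (('g, nat) gset \<times> ('g, nat) gset) set \<Rightarrow> int" where
  "orb_euler H a =
     (THE n. \<forall>(S, T)\<in>a. of_int n = gset_orb_euler H S - gset_orb_euler H T)"

definition complex_units :: "complex monoid" where
  "complex_units = \<lparr>carrier = UNIV - {0}, mult = (*), one = 1\<rparr>"

text \<open>Characters are made extensional, so that they are determined by their values on the group.\<close>

definition character_group :: "('g, 'm) monoid_scheme \<Rightarrow> ('g \<Rightarrow> complex) monoid" where
  "character_group H =
     \<lparr>carrier = hom H complex_units \<inter> extensional (carrier H),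
      mult = (\<lambda>\<alpha> \<beta>. \<lambda>g\<in>carrier H. \<alpha> g * \<beta> g),
      one = (\<lambda>g\<in>carrier H. 1)\<rparr>"

definition dual_subgroup :: "('g, 'm) monoid_scheme \<Rightarrow> 'g set \<Rightarrow> ('g \<Rightarrow> complex) set" where
  "dual_subgroup H K = {\<alpha> \<in> carrier (character_group H). \<forall>g\<in>K. \<alpha> g = 1}"

text \<open>The classes of the coset spaces generate the additive group of the Burnside ring, so a
  homomorphism with the prescribed values is unique; it exists because they generate it freely,
  distinct subgroups of an abelian group being non-conjugate.\<close>

definition saito_duality ::
    "('g, 'm) monoid_scheme \<Rightarrow> (('g, nat) gset \<times> ('g, nat) gset) set
      \<Rightarrow> (('g \<Rightarrow> complex, nat) gset \<times> ('g \<Rightarrow> complex, nat) gset) set" where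
  "saito_duality H =
     (THE D. D \<in> hom (add_monoid (burnside_ring H)) (add_monoid (burnside_ring (character_group H))) \<and>
             D \<in> extensional (carrier (burnside_ring H)) \<and>
             (\<forall>K. subgroup K H \<longrightarrow>
                D (burnside_class H (gset_cosets H K)) =
                burnside_class (character_group H)
                  (gset_cosets (character_group H) (dual_subgroup H K))))"

end

theory Submission
  imports Defs "HOL-Algebra.Multiplicative_Group"
begin

text \<open>Over a finite abelian group \<open>H\<close>, a finite \<open>H\<close>-set \<open>S\<close> is determined up to isomorphism by the
  functional \<open>f \<mapsto> (\<Sum>x\<in>S. f (Stab x))\<close> on functions of subgroups, so \<open>A(H)\<close> embeds into the space
  of these functionals. Reduction to \<open>G\<close> precomposes with \<open>L \<mapsto> L \<inter> G\<close>, the orbifold Euler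
  characteristic evaluates at \<open>K \<mapsto> |K|\<^sup>2 / |H|\<close>, and Saito duality becomes precomposition with
  \<open>f \<mapsto> (K \<mapsto> |K|\<^sup>2 / |H| * f (K~))\<close>, where \<open>K~\<close> is the dual subgroup. The theorem thus reduces to
  \<open>|K|\<^sup>2 / |H| * |K~ \<inter> G~|\<^sup>2 / |G~| = |K \<inter> G|\<^sup>2 / |G|\<close>, which follows from \<open>|K~| = |H| / |K|\<close> and
  \<open>K~ \<inter> G~ = (K G)~\<close>.\<close>

section \<open>Finite sets with an action and sums over stabilizers\<close>

text \<open>The weight |K|^2 / |H| arises for two separate reasons. A point with stabilizer K is
  fixed by |K|^2 commuting pairs, and the Euler characteristic divides by |H|. Duality turns an
  orbit of |H| / |K| points into a coset space of the dual subgroup with |K| points, so sums over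
  points are rescaled by the same quotient. Summing over points rather than orbits keeps restriction
  to a subgroup simple, although restriction breaks orbits up; the price is rational values, and
  integrality has to be regained orbit by orbit. The functional is complete because the group is
  abelian: all points of an orbit share one stabilizer, which fixes the type of the orbit. Elements
  of the Burnside ring are sets of pairs, and duality and Euler characteristic are definite
  descriptions; once classes are recognised by their functionals, each question of well-definedness
  is an equality of numbers.\<close>

definition stab_sum ::
    "('g, 'm) monoid_scheme \<Rightarrow> ('g, 'x) gset \<Rightarrow> ('g set \<Rightarrow> rat) \<Rightarrow> rat" where
  "stab_sum H S f = (\<Sum>x\<in>fst S. f (stabilizer H (snd S) x))"

text \<open>The permutations are cut down together with the set, because a
  \<open>group_action\<close> consists of maps extensional on its set.\<close>

definition gset_restrict :: "('g, 'x) gset \<Rightarrow> 'x set \<Rightarrow> ('g, 'x) gset" where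
  "gset_restrict S Y = (Y, \<lambda>g. restrict (snd S g) Y)"

text \<open>Pointwise laws suffice: acting by \<open>inv g\<close> inverts \<open>\<phi> g\<close>,
  so each \<open>\<phi> g\<close> is a bijection.\<close>

lemma finite_gsetI:
  fixes H (structure)
  assumes "group H" "finite X"
    and ext: "\<And>g. g \<in> carrier H \<Longrightarrow> \<phi> g \<in> extensional X"
    and closed: "\<And>g x. g \<in> carrier H \<Longrightarrow> x \<in> X \<Longrightarrow> \<phi> g x \<in> X"
    and one: "\<And>x. x \<in> X \<Longrightarrow> \<phi> \<one> x = x"
    and mult: "\<And>g h x. g \<in> carrier H \<Longrightarrow> h \<in> carrier H \<Longrightarrow> x \<in> X \<Longrightarrow> \<phi> (g \<otimes> h) x = \<phi> g (\<phi> h x)"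
  shows "finite_gset H (X, \<phi>)"
proof -
  interpret group H by fact
  have bij: "\<phi> g \<in> Bij X" if g: "g \<in> carrier H" for g
  proof -
    have "bij_betw (\<phi> g) X X"
    proof (rule bij_betw_byWitness[where f' = "\<phi> (inv g)"])
      show "\<forall>a\<in>X. \<phi> (inv g) (\<phi> g a) = a" "\<forall>a\<in>X. \<phi> g (\<phi> (inv g) a) = a"
        using g by (auto simp: mult[symmetric] one)
    qed (use g closed in auto)
    then show ?thesis using ext g by (simp add: Bij_def)
  qed
  have "\<phi> \<in> hom H (BijGroup X)"
  proof (rule homI)
    fix g h assume gh: "g \<in> carrier H" "h \<in> carrier H"
    have "\<phi> (g \<otimes> h) = compose X (\<phi> g) (\<phi> h)"
      using gh ext[of "g \<otimes> h"] mult by (intro extensionalityI[of _ X]) (auto simp: compose_def)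
    then show "\<phi> (g \<otimes> h) = \<phi> g \<otimes>\<^bsub>BijGroup X\<^esub> \<phi> h" using gh bij by (simp add: BijGroup_def)
  qed (use bij in \<open>simp add: BijGroup_def\<close>)
  then have "group_action H X \<phi>"
    by (simp add: group_action_def group_hom_def group_hom_axioms_def group_BijGroup is_group)
  then show ?thesis using assms by (simp add: finite_gset_def)
qed

context
  fixes H :: "('g, 'm) monoid_scheme" (structure) and S :: "('g, 'x) gset"
  assumes S: "finite_gset H S"
begin

lemma gset_action: "group_action H (fst S) (snd S)"
  using S by (simp add: finite_gset_def)

lemma gset_finite: "finite (fst S)"
  using S by (simp add: finite_gset_def)

lemma gset_group: "group H"
  using gset_action by (simp add: group_action_def group_hom_def)

lemma gset_closed: "g \<in> carrier H \<Longrightarrow> x \<in> fst S \<Longrightarrow> snd S g x \<in> fst S"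
  using group_action.element_image[OF gset_action] by blast

lemma gset_one: "x \<in> fst S \<Longrightarrow> snd S \<one> x = x"
  using group_action.id_eq_one[OF gset_action] by (metis restrict_apply')

lemma gset_mult:
  "g \<in> carrier H \<Longrightarrow> h \<in> carrier H \<Longrightarrow> x \<in> fst S \<Longrightarrow> snd S (g \<otimes> h) x = snd S g (snd S h x)"
  using group_action.composition_rule[OF gset_action] by blast

lemma gset_inv: "g \<in> carrier H \<Longrightarrow> x \<in> fst S \<Longrightarrow> snd S (inv g) (snd S g x) = x"
  using group_action.orbit_sym_aux[OF gset_action] by blast

lemma finite_gset_restrict:
  assumes "Y \<subseteq> fst S" "\<And>g x. g \<in> carrier H \<Longrightarrow> x \<in> Y \<Longrightarrow> snd S g x \<in> Y"
  shows "finite_gset H (gset_restrict S Y)"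
  unfolding gset_restrict_def
  using assms gset_group finite_subset[OF assms(1) gset_finite]
  by (intro finite_gsetI) (auto simp: gset_one gset_mult subset_iff group.is_monoid)

lemma stab_sum_gset_restrict:
  "stab_sum H (gset_restrict S Y) f = (\<Sum>x\<in>Y. f (stabilizer H (snd S) x))"
  by (auto simp: stab_sum_def stabilizer_def gset_restrict_def intro!: sum.cong)

lemma stab_sum_restrict:
  assumes "Y \<subseteq> fst S"
  shows "stab_sum H S f = stab_sum H (gset_restrict S Y) f + stab_sum H (gset_restrict S (fst S - Y)) f"
  unfolding stab_sum_gset_restrict using sum.subset_diff[OF assms gset_finite]
  by (simp add: stab_sum_def add.commute)

lemma orbit_subset: "x \<in> fst S \<Longrightarrow> orbit H (snd S) x \<subseteq> fst S"
  using gset_closed by (auto simp: orbit_def)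

lemma orbit_closed:
  "g \<in> carrier H \<Longrightarrow> x \<in> fst S \<Longrightarrow> y \<in> orbit H (snd S) x \<Longrightarrow> snd S g y \<in> orbit H (snd S) x"
  unfolding orbit_def using gset_mult[symmetric] monoid.m_closed[OF group.is_monoid[OF gset_group]]
  by blast

lemma orbit_compl_closed:
  assumes "g \<in> carrier H" "x \<in> fst S" "y \<in> fst S - orbit H (snd S) x"
  shows "snd S g y \<in> fst S - orbit H (snd S) x"
proof -
  interpret group H by (rule gset_group)
  have "y \<in> orbit H (snd S) x" if "snd S g y \<in> orbit H (snd S) x"
    using orbit_closed[OF _ assms(2) that, of "inv g"] gset_inv assms by auto
  then show ?thesis using assms gset_closed by blast
qed

lemma finite_gset_orbit_compl:
  "x \<in> fst S \<Longrightarrow> finite_gset H (gset_restrict S (fst S - orbit H (snd S) x))"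
  by (rule finite_gset_restrict[OF Diff_subset orbit_compl_closed])

lemma orbit_eq: "x \<in> fst S \<Longrightarrow> y \<in> orbit H (snd S) x \<Longrightarrow> orbit H (snd S) y = orbit H (snd S) x"
  by (meson S gset_action group_action.orbit_sym group_action.orbit_trans in_mono orbit_subset subsetI subset_antisym)

end

lemma finite_gset_empty: "group H \<Longrightarrow> finite_gset H gset_empty"
  unfolding gset_empty_def by (rule finite_gsetI) auto

lemma stab_sum_empty [simp]: "stab_sum H gset_empty f = 0"
  by (simp add: stab_sum_def gset_empty_def)

lemma finite_gset_sum:
  assumes S: "finite_gset H S" and T: "finite_gset H T"
  shows "finite_gset H (gset_sum S T)"
  unfolding gset_sum_def
  using gset_finite[OF S] gset_finite[OF T] gset_group[OF S]
    gset_closed[OF S] gset_closed[OF T] gset_one[OF S] gset_one[OF T] gset_mult[OF S] gset_mult[OF T]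
  by (intro finite_gsetI) (auto simp: group.is_monoid)

lemma stab_sum_gset_sum:
  assumes S: "finite_gset H S" and T: "finite_gset H T"
  shows "stab_sum H (gset_sum S T) f = stab_sum H S f + stab_sum H T f"
proof -
  have "stabilizer H (snd (gset_sum S T)) (Inl x) = stabilizer H (snd S) x" if "x \<in> fst S" for x
    using that by (auto simp: stabilizer_def gset_sum_def)
  moreover have "stabilizer H (snd (gset_sum S T)) (Inr x) = stabilizer H (snd T) x" if "x \<in> fst T" for x
    using that by (auto simp: stabilizer_def gset_sum_def)
  moreover have "fst (gset_sum S T) = fst S <+> fst T" by (simp add: gset_sum_def)
  ultimately show ?thesis
    by (simp add: stab_sum_def sum.Plus gset_finite[OF S] gset_finite[OF T])
qed

text \<open>An equivariant injection preserves stabilizers. This is the easy half of the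
  classification by functionals.\<close>

lemma stab_sum_cong_isomorphic:
  assumes S: "finite_gset H S" and "gset_isomorphic H S T"
  shows "stab_sum H S f = stab_sum H T f"
proof -
  obtain k where k: "bij_betw k (fst S) (fst T)"
    and eq: "\<And>g x. g \<in> carrier H \<Longrightarrow> x \<in> fst S \<Longrightarrow> k (snd S g x) = snd T g (k x)"
    using assms(2) unfolding gset_isomorphic_def by blast
  have "stabilizer H (snd T) (k x) = stabilizer H (snd S) x" if "x \<in> fst S" for x
    unfolding stabilizer_def
    using that k eq[symmetric] gset_closed[OF S] by (auto simp: bij_betw_def inj_on_eq_iff)
  then show ?thesis
    unfolding stab_sum_def by (simp add: sum.reindex_bij_betw[OF k, symmetric])
qed

text \<open>Coset spaces and dual sets live on other types; this moves them to the natural numbers,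
  over which the Burnside ring is built.\<close>

lemma obtain_nat_gset:
  assumes S: "finite_gset H S"
  obtains U :: "('g, nat) gset" where "finite_gset H U" "gset_isomorphic H S U"
proof -
  obtain k :: "_ \<Rightarrow> nat" where k: "inj_on k (fst S)"
    using finite_imp_inj_to_nat_seg[OF gset_finite[OF S]] by blast
  define X where "X = k ` fst S"
  define \<phi> where "\<phi> = (\<lambda>g. \<lambda>n\<in>X. k (snd S g (inv_into (fst S) k n)))"
  have \<phi>: "\<phi> g (k x) = k (snd S g x)" if "x \<in> fst S" for g x
    using that k by (simp add: \<phi>_def X_def)
  have "finite_gset H (X, \<phi>)"
  proof (rule finite_gsetI)
    show "\<phi> g \<in> extensional X" for g by (simp add: \<phi>_def)
  qed (use gset_group[OF S] gset_finite[OF S] gset_closed[OF S] gset_one[OF S] gset_mult[OF S] \<phi>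
       in \<open>auto simp: X_def\<close>)
  moreover have "gset_isomorphic H S (X, \<phi>)"
    unfolding gset_isomorphic_def using k \<phi> by (auto simp: X_def bij_betw_def)
  ultimately show thesis by (rule that)
qed

section \<open>Orbits and stabilizers in a finite abelian group\<close>

locale finite_comm_group = comm_group H for H (structure) +
  assumes finite_carrier: "finite (carrier H)"
begin

text \<open>In general the stabilizer of g x is conjugate to that of x; here \<open>h\<close> and
  \<open>g\<close> commute, so h g x = g h x, and \<open>g\<close> acts injectively.\<close>

lemma stabilizer_translate:
  assumes S: "finite_gset H S" and "g \<in> carrier H" "x \<in> fst S"
  shows "stabilizer H (snd S) (snd S g x) = stabilizer H (snd S) x"
proof -
  have "snd S h (snd S g x) = snd S g x \<longleftrightarrow> snd S h x = x" if h: "h \<in> carrier H" for h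
  proof -
    have "snd S h (snd S g x) = snd S g (snd S h x)"
      using assms h gset_mult[OF S] m_comm by metis
    then show ?thesis using assms h gset_closed[OF S] gset_inv[OF S] by metis
  qed
  then show ?thesis by (auto simp: stabilizer_def)
qed

lemma stabilizer_orbit:
  assumes "finite_gset H S" "x \<in> fst S" "y \<in> orbit H (snd S) x"
  shows "stabilizer H (snd S) y = stabilizer H (snd S) x"
  using assms stabilizer_translate by (fastforce simp: orbit_def)

lemma finite_subgroup: "subgroup K H \<Longrightarrow> finite K"
  using finite_carrier finite_subset subgroup.subset by blast

lemma card_subgroup_pos: "subgroup K H \<Longrightarrow> card K > 0"
  using finite_subgroup subgroup.one_closed by (auto simp: card_gt_0_iff)

lemma order_pos: "order H > 0"
  using finite_carrier order_gt_0_iff_finite by blast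

lemma stab_sum_orbit:
  assumes S: "finite_gset H S" and x: "x \<in> fst S"
  shows "stab_sum H (gset_restrict S (orbit H (snd S) x)) f =
    of_nat (order H) / of_nat (card (stabilizer H (snd S) x)) * f (stabilizer H (snd S) x)"
proof -
  have "stab_sum H (gset_restrict S (orbit H (snd S) x)) f =
      of_nat (card (orbit H (snd S) x)) * f (stabilizer H (snd S) x)"
    by (simp add: stab_sum_gset_restrict[OF S] stabilizer_orbit[OF S x])
  moreover have "card (orbit H (snd S) x) * card (stabilizer H (snd S) x) = order H"
    using group_action.orbit_stabilizer_theorem[OF gset_action[OF S] x] .
  moreover have "card (stabilizer H (snd S) x) > 0"
    using group_action.stabilizer_subgroup[OF gset_action[OF S] x] card_subgroup_pos by blast
  ultimately show ?thesis
    by (simp add: field_simps flip: of_nat_mult)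
qed

text \<open>The functional detects which stabilizers occur, so an orbit of \<open>S\<close> can be
  matched with an orbit of \<open>T\<close> of the same stabilizer. Removing both leaves sets whose
  functionals still agree.\<close>

lemma isomorphic_if_stab_sum_eq:
  assumes "finite_gset H (S :: ('a, 'x) gset)" "finite_gset H (T :: ('a, 'y) gset)"
    and "\<And>f. stab_sum H S f = stab_sum H T f"
  shows "gset_isomorphic H S T"
  using assms
proof (induction "card (fst S)" arbitrary: S T rule: less_induct)
  case less
  note S = less.prems(1) and T = less.prems(2) and eq = less.prems(3)
  show ?case
  proof (cases "fst S = {}")
    case True
    \<comment> \<open>The constant function 1 counts points.\<close>
    then have "stab_sum H T (\<lambda>_. 1) = 0" using eq[of "\<lambda>_. 1"] by (simp add: stab_sum_def)
    then have "fst T = {}" using gset_finite[OF T] by (simp add: stab_sum_def)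
    then show ?thesis using True by (simp add: gset_isomorphic_def bij_betw_def)
  next
    case False
    then obtain x where x: "x \<in> fst S" by blast
    define K where "K = stabilizer H (snd S) x"
    obtain y where y: "y \<in> fst T" and yK: "stabilizer H (snd T) y = K"
    proof -
      \<comment> \<open>The indicator of \<open>K\<close> counts the points with stabilizer exactly
        \<open>K\<close>, and \<open>x\<close> is one of them.\<close>
      have "stab_sum H S (\<lambda>L. of_bool (L = K)) > 0"
        unfolding stab_sum_def using gset_finite[OF S] x by (intro sum_pos2[of _ x]) (auto simp: K_def)
      then have "stab_sum H T (\<lambda>L. of_bool (L = K)) \<noteq> 0" by (simp add: eq)
      then have "\<exists>y\<in>fst T. stabilizer H (snd T) y = K"
        unfolding stab_sum_def by (metis (mono_tags, lifting) of_bool_eq_0_iff sum.neutral)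
      with that show thesis by blast
    qed
    define O1 where "O1 = orbit H (snd S) x"
    define O2 where "O2 = orbit H (snd T) y"
    define S' where "S' = gset_restrict S (fst S - O1)"
    define T' where "T' = gset_restrict T (fst T - O2)"
    have O1: "x \<in> O1" "O1 \<subseteq> fst S" and O2: "y \<in> O2" "O2 \<subseteq> fst T"
      unfolding O1_def O2_def
      using x y orbit_subset[OF S] orbit_subset[OF T] group_action.orbit_refl gset_action S T by metis+
    have S': "finite_gset H S'" and T': "finite_gset H T'"
      unfolding S'_def T'_def O1_def O2_def
      using finite_gset_orbit_compl[OF S x] finite_gset_orbit_compl[OF T y] by auto
    have "card (fst S') < card (fst S)"
      unfolding S'_def gset_restrict_def using O1 x gset_finite[OF S] by (auto intro!: psubset_card_mono)
    moreover have "stab_sum H S' f = stab_sum H T' f" for f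
      using eq[of f] stab_sum_restrict[OF S O1(2), of f] stab_sum_restrict[OF T O2(2), of f]
        stab_sum_orbit[OF S x, of f] stab_sum_orbit[OF T y, of f]
      by (simp add: S'_def T'_def O1_def O2_def yK K_def)
    ultimately have "gset_isomorphic H S' T'"
      using less.hyps S' T' by blast
    then obtain k where k: "bij_betw k (fst S - O1) (fst T - O2)"
      and k_eq: "\<And>g z. g \<in> carrier H \<Longrightarrow> z \<in> fst S - O1 \<Longrightarrow> k (snd S g z) = snd T g (k z)"
    proof -
      obtain k where bij: "bij_betw k (fst S - O1) (fst T - O2)"
        and eq: "\<forall>g\<in>carrier H. \<forall>z\<in>fst S - O1. k (snd S g z) = snd T' g (k z)"
        using \<open>gset_isomorphic H S' T'\<close> unfolding gset_isomorphic_def S'_def T'_def gset_restrict_def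
        by auto
      have "snd T' g (k z) = snd T g (k z)" if "z \<in> fst S - O1" for g z
        using bij_betwE[OF bij] that by (simp add: T'_def gset_restrict_def)
      with bij eq that show thesis by simp
    qed
    \<comment> \<open>The map g x to g y on the chosen orbits, with \<open>g\<close> any element
      carrying \<open>x\<close> to the argument.\<close>
    define l where "l = (\<lambda>z. snd T (SOME g. g \<in> carrier H \<and> snd S g x = z) y)"
    \<comment> \<open>Both equalities say that g^-1 h lies in the common stabilizer
      \<open>K\<close>. One direction makes \<open>l\<close> well defined, the other makes it
      injective.\<close>
    have same: "snd S g x = snd S h x \<longleftrightarrow> snd T g y = snd T h y"
      if "g \<in> carrier H" "h \<in> carrier H" for g h
    proof -
      have "snd S g x = snd S h x \<longleftrightarrow> inv g \<otimes> h \<in> stabilizer H (snd S) x"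
        using that x gset_mult[OF S, of "inv g" h x] gset_mult[OF S, of g "inv g \<otimes> h" x] gset_inv[OF S, of g x]
        by (auto simp: stabilizer_def m_assoc[symmetric])
      moreover have "snd T g y = snd T h y \<longleftrightarrow> inv g \<otimes> h \<in> stabilizer H (snd T) y"
        using that y gset_mult[OF T, of "inv g" h y] gset_mult[OF T, of g "inv g \<otimes> h" y] gset_inv[OF T, of g y]
        by (auto simp: stabilizer_def m_assoc[symmetric])
      ultimately show ?thesis by (simp add: yK K_def)
    qed
    have l: "l (snd S g x) = snd T g y" if g: "g \<in> carrier H" for g
    proof -
      define h where "h = (SOME h. h \<in> carrier H \<and> snd S h x = snd S g x)"
      have "h \<in> carrier H \<and> snd S h x = snd S g x"
        unfolding h_def by (rule someI[of _ g]) (use g in auto)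
      then have "snd T h y = snd T g y" using same[of h g] g by simp
      then show ?thesis by (simp add: l_def h_def)
    qed
    have l_bij: "bij_betw l O1 O2"
      unfolding bij_betw_def
    proof
      show "inj_on l O1" by (auto simp: inj_on_def O1_def orbit_def l same)
      have "O1 = (\<lambda>g. snd S g x) ` carrier H" "O2 = (\<lambda>g. snd T g y) ` carrier H"
        by (auto simp: O1_def O2_def orbit_def)
      then show "l ` O1 = O2" by (simp add: image_image l cong: image_cong)
    qed
    have l_eq: "l (snd S g z) = snd T g (l z)" if "g \<in> carrier H" "z \<in> O1" for g z
      using that x y by (auto simp: O1_def orbit_def l gset_mult[OF S, symmetric] gset_mult[OF T, symmetric])
    define m where "m = (\<lambda>z. if z \<in> O1 then l z else k z)"
    have "bij_betw m O1 O2"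
      using l_bij by (rule bij_betw_cong[THEN iffD1, rotated]) (simp add: m_def)
    moreover have "bij_betw m (fst S - O1) (fst T - O2)"
      using k by (rule bij_betw_cong[THEN iffD1, rotated]) (simp add: m_def)
    ultimately have "bij_betw m (O1 \<union> (fst S - O1)) (O2 \<union> (fst T - O2))"
      by (rule bij_betw_combine) blast
    then have "bij_betw m (fst S) (fst T)" using O1 O2 by (simp add: Un_absorb1)
    moreover have "m (snd S g z) = snd T g (m z)" if "g \<in> carrier H" "z \<in> fst S" for g z
      using that l_eq[of g z] k_eq[of g z] orbit_closed[OF S _ x, of g z] orbit_compl_closed[OF S _ x, of g z]
      by (auto simp: m_def O1_def)
    ultimately show ?thesis unfolding gset_isomorphic_def by blast
  qed
qed

end

section \<open>The additive group of the Burnside ring\<close>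

text \<open>The functional of a class is read off an arbitrary representing pair;
  \<open>burnside_mem_iff\<close> shows that all pairs of a class agree.\<close>

definition burnside_val ::
    "('g, 'm) monoid_scheme \<Rightarrow> (('g, nat) gset \<times> ('g, nat) gset) set \<Rightarrow> ('g set \<Rightarrow> rat) \<Rightarrow> rat" where
  "burnside_val H a f = (let (U, V) = SOME p. p \<in> a in stab_sum H U f - stab_sum H V f)"

context finite_comm_group
begin

text \<open>The auxiliary summand \<open>Z\<close> cancels once isomorphism is expressed by rational
  numbers. Conversely, equal functionals already give an isomorphism, so the empty set can serve as
  \<open>Z\<close>.\<close>

lemma burnside_diff_eq:
  assumes S: "finite_gset H S" and T: "finite_gset H T"
  shows "burnside_diff H S T = {(U, V). finite_gset H U \<and> finite_gset H V \<and>
    (\<forall>f. stab_sum H U f - stab_sum H V f = stab_sum H S f - stab_sum H T f)}"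
proof -
  have "(\<exists>Z :: ('a, nat) gset. finite_gset H Z \<and>
           gset_isomorphic H (gset_sum (gset_sum S V) Z) (gset_sum (gset_sum U T) Z)) \<longleftrightarrow>
        (\<forall>f. stab_sum H U f - stab_sum H V f = stab_sum H S f - stab_sum H T f)"
    (is "?L \<longleftrightarrow> ?R")
    if U: "finite_gset H U" and V: "finite_gset H V" for U V :: "('a, nat) gset"
  proof
    assume ?L
    then obtain Z :: "('a, nat) gset" where Z: "finite_gset H Z"
      and iso: "gset_isomorphic H (gset_sum (gset_sum S V) Z) (gset_sum (gset_sum U T) Z)" by blast
    have "stab_sum H (gset_sum (gset_sum S V) Z) f = stab_sum H (gset_sum (gset_sum U T) Z) f" for f
      using iso by (rule stab_sum_cong_isomorphic[rotated]) (intro finite_gset_sum S V Z)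
    then show ?R
      using S T U V Z by (simp add: stab_sum_gset_sum finite_gset_sum) (simp add: algebra_simps)
  next
    assume R: ?R
    have E: "finite_gset H (gset_empty :: ('a, nat) gset)" by (rule finite_gset_empty) (rule is_group)
    have "gset_isomorphic H (gset_sum (gset_sum S V) (gset_empty :: ('a, nat) gset))
        (gset_sum (gset_sum U T) (gset_empty :: ('a, nat) gset))"
    proof (rule isomorphic_if_stab_sum_eq)
      show "stab_sum H (gset_sum (gset_sum S V) (gset_empty :: ('a, nat) gset)) f =
          stab_sum H (gset_sum (gset_sum U T) (gset_empty :: ('a, nat) gset)) f" for f
        using R[rule_format, of f] S T U V E by (simp add: stab_sum_gset_sum finite_gset_sum)
    qed (intro finite_gset_sum S T U V E)+
    with E show ?L by blast
  qed
  then show ?thesis unfolding burnside_diff_def by blast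
qed

lemma burnside_carrierE:
  assumes "a \<in> carrier (burnside_ring H)"
  obtains S T :: "('a, nat) gset"
  where "finite_gset H S" "finite_gset H T" "a = burnside_diff H S T"
  using assms unfolding burnside_ring_def by simp blast

lemma burnside_mem_iff:
  assumes a: "a \<in> carrier (burnside_ring H)"
  shows "(U, V) \<in> a \<longleftrightarrow> finite_gset H U \<and> finite_gset H V \<and>
    (\<forall>f. stab_sum H U f - stab_sum H V f = burnside_val H a f)"
proof -
  obtain S T :: "('a, nat) gset"
    where S: "finite_gset H S" and T: "finite_gset H T" and eq: "a = burnside_diff H S T"
    by (rule burnside_carrierE[OF a])
  have "(S, T) \<in> a" using S T by (simp add: eq burnside_diff_eq)
  then have "(SOME p. p \<in> a) \<in> a" by (metis someI)
  then have "burnside_val H a f = stab_sum H S f - stab_sum H T f" for f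
    unfolding burnside_val_def by (auto simp: eq burnside_diff_eq S T)
  then show ?thesis by (simp add: eq burnside_diff_eq S T)
qed

text \<open>\<open>S\<close> and \<open>T\<close> may live on any types: isomorphic copies over the
  natural numbers represent the same difference.\<close>

lemma
  assumes S: "finite_gset H S" and T: "finite_gset H T"
  shows burnside_diff_closed: "burnside_diff H S T \<in> carrier (burnside_ring H)"
    and burnside_val_diff: "burnside_val H (burnside_diff H S T) f = stab_sum H S f - stab_sum H T f"
proof -
  obtain U :: "('a, nat) gset" where U: "finite_gset H U" "gset_isomorphic H S U"
    by (rule obtain_nat_gset[OF S])
  obtain V :: "('a, nat) gset" where V: "finite_gset H V" "gset_isomorphic H T V"
    by (rule obtain_nat_gset[OF T])
  have UV: "(U, V) \<in> burnside_diff H S T"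
    using U V S T by (simp add: burnside_diff_eq stab_sum_cong_isomorphic)
  have "burnside_diff H S T = burnside_diff H U V"
    using U V S T by (simp add: burnside_diff_eq stab_sum_cong_isomorphic)
  then show closed: "burnside_diff H S T \<in> carrier (burnside_ring H)"
    using U V unfolding burnside_ring_def partial_object.simps by blast
  have "stab_sum H U f - stab_sum H V f = burnside_val H (burnside_diff H S T) f"
    using UV unfolding burnside_mem_iff[OF closed] by blast
  moreover have "stab_sum H U f - stab_sum H V f = stab_sum H S f - stab_sum H T f"
    using UV unfolding burnside_diff_eq[OF S T] by blast
  ultimately show "burnside_val H (burnside_diff H S T) f = stab_sum H S f - stab_sum H T f" by simp
qed

text \<open>Injectivity of the passage to functionals: a class contains exactly the pairs with its
  values. All later equalities in the ring are proved this way.\<close>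

lemma burnside_eqI:
  assumes "a \<in> carrier (burnside_ring H)" "b \<in> carrier (burnside_ring H)"
    and "\<And>f. burnside_val H a f = burnside_val H b f"
  shows "a = b"
  using assms by (auto simp: burnside_mem_iff)

lemma burnside_rep:
  assumes "a \<in> carrier (burnside_ring H)"
  obtains S T where "(S, T) \<in> a" "finite_gset H S" "finite_gset H T"
  using assms by (metis burnside_carrierE burnside_mem_iff burnside_val_diff)

text \<open>The union defining the sum runs over all representing pairs. Each choice yields the same
  class, since the functional of the result is the sum of the two given ones, and the index sets are
  nonempty; so the union collapses to one class.\<close>

lemma
  assumes a: "a \<in> carrier (burnside_ring H)" and b: "b \<in> carrier (burnside_ring H)"
  shows burnside_add_closed: "a \<oplus>\<^bsub>burnside_ring H\<^esub> b \<in> carrier (burnside_ring H)"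
    and burnside_val_add:
      "burnside_val H (a \<oplus>\<^bsub>burnside_ring H\<^esub> b) f = burnside_val H a f + burnside_val H b f"
proof -
  obtain S T where ST: "(S, T) \<in> a" "finite_gset H S" "finite_gset H T" by (rule burnside_rep[OF a])
  obtain S' T' where ST': "(S', T') \<in> b" "finite_gset H S'" "finite_gset H T'" by (rule burnside_rep[OF b])
  note va = burnside_mem_iff[OF a, THEN iffD1, THEN conjunct2, THEN conjunct2, rule_format]
  note vb = burnside_mem_iff[OF b, THEN iffD1, THEN conjunct2, THEN conjunct2, rule_format]
  have eq: "burnside_diff H (gset_sum U U') (gset_sum V V') = burnside_diff H (gset_sum S S') (gset_sum T T')"
    if "(U, V) \<in> a" "(U', V') \<in> b" for U V U' V'
  proof (rule burnside_eqI)
    have "finite_gset H U" "finite_gset H V" "finite_gset H U'" "finite_gset H V'"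
      using that burnside_mem_iff[OF a, of U V] burnside_mem_iff[OF b, of U' V'] by blast+
    then show "burnside_val H (burnside_diff H (gset_sum U U') (gset_sum V V')) f =
        burnside_val H (burnside_diff H (gset_sum S S') (gset_sum T T')) f" for f
      using ST(2,3) ST'(2,3) va[OF that(1), of f] vb[OF that(2), of f] va[OF ST(1), of f] vb[OF ST'(1), of f]
      by (simp add: burnside_val_diff finite_gset_sum stab_sum_gset_sum)
  qed (use that ST(2,3) ST'(2,3) burnside_mem_iff[OF a, of U V] burnside_mem_iff[OF b, of U' V']
       in \<open>simp_all add: burnside_diff_closed finite_gset_sum\<close>)
  have "a \<oplus>\<^bsub>burnside_ring H\<^esub> b = burnside_diff H (gset_sum S S') (gset_sum T T')"
  proof -
    have "a \<oplus>\<^bsub>burnside_ring H\<^esub> b = (\<Union>(U, V)\<in>a. \<Union>(U', V')\<in>b. burnside_diff H (gset_sum U U') (gset_sum V V'))"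
      by (simp add: burnside_ring_def)
    also have "\<dots> = (\<Union>p\<in>a. \<Union>q\<in>b. burnside_diff H (gset_sum S S') (gset_sum T T'))"
      by (intro SUP_cong refl) (auto dest: eq)
    also have "\<dots> = burnside_diff H (gset_sum S S') (gset_sum T T')" using ST ST' by auto
    finally show ?thesis .
  qed
  then show "a \<oplus>\<^bsub>burnside_ring H\<^esub> b \<in> carrier (burnside_ring H)"
    and "burnside_val H (a \<oplus>\<^bsub>burnside_ring H\<^esub> b) f = burnside_val H a f + burnside_val H b f"
    using ST(2,3) ST'(2,3) va[OF ST(1), of f] vb[OF ST'(1), of f]
    by (simp_all add: burnside_diff_closed burnside_val_diff finite_gset_sum stab_sum_gset_sum)
qed

end

section \<open>Reduction and the orbifold Euler characteristic\<close>

lemma finite_gset_subgroup: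
  assumes S: "finite_gset H S" and K: "subgroup K H"
  shows "finite_gset (H\<lparr>carrier := K\<rparr>) S"
proof -
  have "finite_gset (H\<lparr>carrier := K\<rparr>) (fst S, snd S)"
  proof (rule finite_gsetI)
    show "group (H\<lparr>carrier := K\<rparr>)"
      using K gset_group[OF S] by (rule subgroup.subgroup_is_group)
    show "snd S g \<in> extensional (fst S)" if "g \<in> carrier (H\<lparr>carrier := K\<rparr>)" for g
      using that group_action.bij_prop0[OF gset_action[OF S]] subgroup.subset[OF K] Bij_imp_extensional by auto
  qed (use gset_finite[OF S] gset_closed[OF S] gset_one[OF S] gset_mult[OF S] subgroup.subset[OF K]
       in \<open>auto simp: subset_iff\<close>)
  then show ?thesis by simp
qed

lemma stab_sum_subgroup:
  assumes "K \<subseteq> carrier H"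
  shows "stab_sum (H\<lparr>carrier := K\<rparr>) S f = stab_sum H S (\<lambda>L. f (L \<inter> K))"
proof -
  have "stabilizer (H\<lparr>carrier := K\<rparr>) (snd S) x = stabilizer H (snd S) x \<inter> K" for x
    using assms by (auto simp: stabilizer_def)
  then show ?thesis by (simp add: stab_sum_def)
qed

text \<open>The choice depends only on the orbit as a set, so all its points receive the same
  representative and each orbit is represented once.\<close>

definition orbit_reps :: "('g, 'm) monoid_scheme \<Rightarrow> ('g, 'x) gset \<Rightarrow> 'x set" where
  "orbit_reps H S = (\<lambda>x. SOME y. y \<in> orbit H (snd S) x) ` fst S"

definition euler_weight :: "('g, 'm) monoid_scheme \<Rightarrow> 'g set \<Rightarrow> rat" where
  "euler_weight H K = of_nat (card K) ^ 2 / of_nat (order H)"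

context finite_comm_group
begin

lemma subgroup_finite_comm_group: "subgroup K H \<Longrightarrow> finite_comm_group (H\<lparr>carrier := K\<rparr>)"
  using group.group_comm_groupI[OF subgroup_imp_group, of K] finite_subgroup subgroup.mem_carrier[of K H] m_comm
  by (simp add: finite_comm_group_def finite_comm_group_axioms_def)

text \<open>A sum over orbits becomes a sum over points when each point carries the reciprocal of
  the length of its orbit, which is |K| / |H| for the stabilizer K.\<close>

lemma
  assumes S: "finite_gset H S"
  shows orbit_reps_subset: "orbit_reps H S \<subseteq> fst S"
    and sum_orbit_reps: "(\<Sum>r\<in>orbit_reps H S. f (stabilizer H (snd S) r)) =
      stab_sum H S (\<lambda>K. of_nat (card K) / of_nat (order H) * f K)"
proof -
  define \<rho> where "\<rho> = (\<lambda>x. SOME y. y \<in> orbit H (snd S) x)"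
  have \<rho>: "\<rho> x \<in> orbit H (snd S) x" if "x \<in> fst S" for x
    unfolding \<rho>_def using group_action.orbit_refl[OF gset_action[OF S] that] by (rule someI)
  have reps: "orbit_reps H S = \<rho> ` fst S" by (simp add: orbit_reps_def \<rho>_def)
  show sub: "orbit_reps H S \<subseteq> fst S" using \<rho> orbit_subset[OF S] by (auto simp: reps)
  have fibre: "{x \<in> fst S. \<rho> x = r} = orbit H (snd S) r" if "r \<in> \<rho> ` fst S" for r
  proof -
    from that obtain z where z: "z \<in> fst S" "r = \<rho> z" by blast
    have r: "r \<in> fst S" "orbit H (snd S) r = orbit H (snd S) z"
      using \<rho>[OF z(1)] orbit_subset[OF S z(1)] orbit_eq[OF S z(1) \<rho>[OF z(1)]] unfolding z(2) by blast+
    have "\<rho> x = r" if "x \<in> orbit H (snd S) r" for x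
      using orbit_eq[OF S r(1) that] r(2) z(2) by (simp add: \<rho>_def)
    moreover have "x \<in> orbit H (snd S) (\<rho> x)" if "x \<in> fst S" for x
      using orbit_eq[OF S that \<rho>[OF that]] group_action.orbit_refl[OF gset_action[OF S] that] by simp
    ultimately show ?thesis using orbit_subset[OF S r(1)] by auto
  qed
  let ?h = "\<lambda>K. of_nat (card K) / of_nat (order H) * f K"
  have "stab_sum H S ?h = (\<Sum>r\<in>\<rho> ` fst S. \<Sum>x | x \<in> fst S \<and> \<rho> x = r. ?h (stabilizer H (snd S) x))"
    unfolding stab_sum_def by (rule sum.image_gen[OF gset_finite[OF S]])
  also have "\<dots> = (\<Sum>r\<in>\<rho> ` fst S. stab_sum H (gset_restrict S (orbit H (snd S) r)) ?h)"
    by (intro sum.cong refl) (simp add: fibre stab_sum_gset_restrict[OF S])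
  also have "\<dots> = (\<Sum>r\<in>\<rho> ` fst S. f (stabilizer H (snd S) r))"
  proof (rule sum.cong[OF refl])
    fix r assume "r \<in> \<rho> ` fst S"
    then have r: "r \<in> fst S" using sub reps by blast
    have "card (stabilizer H (snd S) r) > 0"
      using group_action.stabilizer_subgroup[OF gset_action[OF S] r] card_subgroup_pos by blast
    then show "stab_sum H (gset_restrict S (orbit H (snd S) r)) ?h = f (stabilizer H (snd S) r)"
      using order_pos by (simp add: stab_sum_orbit[OF S r])
  qed
  finally show "(\<Sum>r\<in>orbit_reps H S. f (stabilizer H (snd S) r)) = stab_sum H S ?h"
    by (simp add: reps)
qed

text \<open>Exchange of summation: a pair (g, h) fixes \<open>x\<close> exactly if both entries lie
  in the stabilizer, so \<open>x\<close> is counted once for each pair from its stabilizer.\<close>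

lemma gset_orb_euler_eq:
  assumes S: "finite_gset H S"
  shows "gset_orb_euler H S = stab_sum H S (euler_weight H)"
proof -
  have fixed: "gset_fixed S (generate H {g, h}) = {x \<in> fst S. g \<in> stabilizer H (snd S) x \<and> h \<in> stabilizer H (snd S) x}"
    if "g \<in> carrier H" "h \<in> carrier H" for g h
  proof -
    have "(\<forall>k\<in>generate H {g, h}. snd S k x = x) \<longleftrightarrow> g \<in> stabilizer H (snd S) x \<and> h \<in> stabilizer H (snd S) x"
      if x: "x \<in> fst S" for x
    proof
      assume "\<forall>k\<in>generate H {g, h}. snd S k x = x"
      then show "g \<in> stabilizer H (snd S) x \<and> h \<in> stabilizer H (snd S) x"
        using \<open>g \<in> carrier H\<close> \<open>h \<in> carrier H\<close> by (auto simp: stabilizer_def generate.incl)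
    next
      assume "g \<in> stabilizer H (snd S) x \<and> h \<in> stabilizer H (snd S) x"
      then have "generate H {g, h} \<subseteq> stabilizer H (snd S) x"
        using generate_subgroup_incl[OF _ group_action.stabilizer_subgroup[OF gset_action[OF S] x]] by simp
      then show "\<forall>k\<in>generate H {g, h}. snd S k x = x" by (auto simp: stabilizer_def)
    qed
    then show ?thesis by (auto simp: gset_fixed_def)
  qed
  have "(\<Sum>(g, h)\<in>{(g, h). g \<in> carrier H \<and> h \<in> carrier H \<and> g \<otimes> h = h \<otimes> g}.
        of_nat (card (gset_fixed S (generate H {g, h}))) :: rat) =
      (\<Sum>(g, h)\<in>carrier H \<times> carrier H. \<Sum>x\<in>fst S.
        of_bool (g \<in> stabilizer H (snd S) x \<and> h \<in> stabilizer H (snd S) x))"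
  proof (rule sum.cong)
    show "{(g, h). g \<in> carrier H \<and> h \<in> carrier H \<and> g \<otimes> h = h \<otimes> g} = carrier H \<times> carrier H"
      by (auto intro: m_comm)
  qed (use gset_finite[OF S] in \<open>auto simp: fixed sum_of_bool_eq Int_def intro!: arg_cong[of _ _ card]\<close>)
  also have "\<dots> = (\<Sum>x\<in>fst S. \<Sum>(g, h)\<in>carrier H \<times> carrier H.
        of_bool (g \<in> stabilizer H (snd S) x \<and> h \<in> stabilizer H (snd S) x))"
    by (simp add: case_prod_unfold sum.swap[of _ "fst S"])
  also have "\<dots> = (\<Sum>x\<in>fst S. of_nat (card (stabilizer H (snd S) x)) ^ 2)"
  proof (rule sum.cong[OF refl])
    fix x
    have "(\<Sum>(g, h)\<in>carrier H \<times> carrier H. of_bool (g \<in> stabilizer H (snd S) x \<and> h \<in> stabilizer H (snd S) x)) =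
        (of_nat (card (stabilizer H (snd S) x \<times> stabilizer H (snd S) x)) :: rat)"
    proof -
      have "stabilizer H (snd S) x \<subseteq> carrier H" by (auto simp: stabilizer_def)
      then have "(carrier H \<times> carrier H) \<inter> {p. fst p \<in> stabilizer H (snd S) x \<and> snd p \<in> stabilizer H (snd S) x} =
          stabilizer H (snd S) x \<times> stabilizer H (snd S) x" by auto
      then show ?thesis using finite_carrier by (simp add: case_prod_unfold sum_of_bool_eq)
    qed
    then show "(\<Sum>(g, h)\<in>carrier H \<times> carrier H. of_bool (g \<in> stabilizer H (snd S) x \<and> h \<in> stabilizer H (snd S) x)) =
        (of_nat (card (stabilizer H (snd S) x)) ^ 2 :: rat)"
      by (simp add: card_cartesian_product power2_eq_square)
  qed
  finally show ?thesis
    by (simp add: gset_orb_euler_def stab_sum_def euler_weight_def sum_divide_distrib)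
qed

text \<open>Single points have fractional weight, but an orbit of type H/K has |H| / |K| points of
  weight |K|^2 / |H| and contributes the integer |K|.\<close>

lemma stab_sum_euler_weight_int:
  assumes S: "finite_gset H S"
  shows "stab_sum H S (euler_weight H) \<in> \<int>"
proof -
  have "stab_sum H S (euler_weight H) = (\<Sum>r\<in>orbit_reps H S. of_nat (card (stabilizer H (snd S) r)))"
    by (simp add: sum_orbit_reps[OF S, of "\<lambda>K. of_nat (card K)"] euler_weight_def[abs_def] power2_eq_square)
  then show ?thesis by (simp add: Ints_sum)
qed

text \<open>The definite description is proper: integrality provides a value, all pairs of
  \<open>a\<close> give the same one, and a single pair forces uniqueness.\<close>

lemma of_int_orb_euler:
  assumes a: "a \<in> carrier (burnside_ring H)"
  shows "of_int (orb_euler H a) = burnside_val H a (euler_weight H)"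
proof -
  have eq: "gset_orb_euler H S - gset_orb_euler H T = burnside_val H a (euler_weight H)" if "(S, T) \<in> a" for S T
    using that unfolding burnside_mem_iff[OF a] by (simp add: gset_orb_euler_eq)
  obtain S T where ST: "(S, T) \<in> a" "finite_gset H S" "finite_gset H T" by (rule burnside_rep[OF a])
  then have "burnside_val H a (euler_weight H) \<in> \<int>"
    using eq[OF ST(1)] stab_sum_euler_weight_int by (metis Ints_diff gset_orb_euler_eq)
  then obtain n where n: "burnside_val H a (euler_weight H) = of_int n" by (auto elim: Ints_cases)
  have "orb_euler H a = n"
    unfolding orb_euler_def
  proof (rule the_equality)
    fix m assume "\<forall>(S, T)\<in>a. of_int m = gset_orb_euler H S - gset_orb_euler H T"
    with ST(1) have "of_int m = gset_orb_euler H S - gset_orb_euler H T" by blast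
    then show "m = n" using eq[OF ST(1)] n by simp
  qed (use eq n in auto)
  then show ?thesis using n by simp
qed

text \<open>As for sums, the union over representing pairs collapses: the functional of the
  restricted difference depends only on the functional of \<open>a\<close>.\<close>

lemma
  assumes a: "a \<in> carrier (burnside_ring H)" and K: "subgroup K H"
  shows burnside_red_closed: "burnside_red H K a \<in> carrier (burnside_ring (H\<lparr>carrier := K\<rparr>))"
    and burnside_val_red:
      "burnside_val (H\<lparr>carrier := K\<rparr>) (burnside_red H K a) f = burnside_val H a (\<lambda>L. f (L \<inter> K))"
proof -
  interpret K: finite_comm_group "H\<lparr>carrier := K\<rparr>" by (rule subgroup_finite_comm_group[OF K])
  obtain S T where ST: "(S, T) \<in> a" "finite_gset H S" "finite_gset H T" by (rule burnside_rep[OF a])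
  have diff: "stab_sum (H\<lparr>carrier := K\<rparr>) U f - stab_sum (H\<lparr>carrier := K\<rparr>) V f = burnside_val H a (\<lambda>L. f (L \<inter> K))"
    if "(U, V) \<in> a" for U V f
    using that unfolding burnside_mem_iff[OF a] by (simp add: stab_sum_subgroup subgroup.subset[OF K])
  have fin: "finite_gset (H\<lparr>carrier := K\<rparr>) U \<and> finite_gset (H\<lparr>carrier := K\<rparr>) V"
    if "(U, V) \<in> a" for U V
    using that K unfolding burnside_mem_iff[OF a] by (blast intro: finite_gset_subgroup)
  have "burnside_diff (H\<lparr>carrier := K\<rparr>) U V = burnside_diff (H\<lparr>carrier := K\<rparr>) S T" if "(U, V) \<in> a" for U V
    using fin[OF that] fin[OF ST(1)] diff[OF that] diff[OF ST(1)]
    by (intro K.burnside_eqI) (auto simp: K.burnside_val_diff intro: K.burnside_diff_closed)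
  then have "burnside_red H K a = (\<Union>p\<in>a. burnside_diff (H\<lparr>carrier := K\<rparr>) S T)"
    unfolding burnside_red_def by (intro SUP_cong refl) auto
  then have "burnside_red H K a = burnside_diff (H\<lparr>carrier := K\<rparr>) S T"
    using ST(1) by auto
  then show "burnside_red H K a \<in> carrier (burnside_ring (H\<lparr>carrier := K\<rparr>))"
    and "burnside_val (H\<lparr>carrier := K\<rparr>) (burnside_red H K a) f = burnside_val H a (\<lambda>L. f (L \<inter> K))"
    using fin[OF ST(1)] diff[OF ST(1)] by (auto simp: K.burnside_val_diff intro: K.burnside_diff_closed)
qed

end

section \<open>Extension of characters and dual subgroups\<close>

text \<open>Dual subgroups need only the trivial \<open>\<chi>\<close>, but enlarging
  \<open>K\<close> step by step produces nontrivial characters, so the counting is set up for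
  arbitrary \<open>\<chi>\<close>.\<close>

definition char_ext :: "('g, 'm) monoid_scheme \<Rightarrow> 'g set \<Rightarrow> ('g \<Rightarrow> complex) \<Rightarrow> ('g \<Rightarrow> complex) set" where
  "char_ext H K \<chi> = {\<alpha> \<in> carrier (character_group H). \<forall>k\<in>K. \<alpha> k = \<chi> k}"

lemma mem_character_group_iff:
  "\<alpha> \<in> carrier (character_group H) \<longleftrightarrow> \<alpha> \<in> extensional (carrier H) \<and> (\<forall>g\<in>carrier H. \<alpha> g \<noteq> 0) \<and>
    (\<forall>g\<in>carrier H. \<forall>h\<in>carrier H. \<alpha> (g \<otimes>\<^bsub>H\<^esub> h) = \<alpha> g * \<alpha> h)"
  by (auto simp: character_group_def complex_units_def hom_def)

lemma dual_subgroup_eq_char_ext: "dual_subgroup H K = char_ext H K (\<lambda>_. 1)"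
  by (simp add: dual_subgroup_def char_ext_def)

context finite_comm_group
begin

lemma character_one: "\<alpha> \<in> carrier (character_group H) \<Longrightarrow> \<alpha> \<one> = 1"
  unfolding mem_character_group_iff by (metis l_one mult_cancel_right2 one_closed)

lemma multiplicative_pow:
  fixes \<chi> :: "'a \<Rightarrow> complex"
  assumes K: "subgroup K H" and "\<And>k. k \<in> K \<Longrightarrow> \<chi> k \<noteq> 0"
    and mult: "\<And>k l. k \<in> K \<Longrightarrow> l \<in> K \<Longrightarrow> \<chi> (k \<otimes> l) = \<chi> k * \<chi> l" and k: "k \<in> K"
  shows "k [^] (i::nat) \<in> K" and "\<chi> (k [^] i) = \<chi> k ^ i"
proof -
  have one: "\<chi> \<one> = 1"
    using assms subgroup.one_closed[OF K] by (metis l_one mult_cancel_right2 one_closed)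
  have "k [^] i \<in> K \<and> \<chi> (k [^] i) = \<chi> k ^ i"
    by (induction i) (use k mult one subgroup.one_closed[OF K] subgroup.m_closed[OF K] in auto)
  then show "k [^] i \<in> K" and "\<chi> (k [^] i) = \<chi> k ^ i" by auto
qed

lemma character_pow:
  assumes "\<alpha> \<in> carrier (character_group H)" "g \<in> carrier H"
  shows "\<alpha> (g [^] (i::nat)) = \<alpha> g ^ i"
  using assms by (intro multiplicative_pow(2)[OF subgroup_self]) (auto simp: mem_character_group_iff)

text \<open>A character of \<open>K\<close> extends to \<open>K'\<close>, generated by \<open>K\<close> and one further element \<open>g\<close>, in exactly
  \<open>n = [K' : K]\<close> ways: the value at \<open>g\<close> may be any \<open>n\<close>-th root of the value at \<open>g ^ n\<close>.\<close>

lemma card_char_ext: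
  assumes "subgroup K H" "\<And>k. k \<in> K \<Longrightarrow> \<chi> k \<noteq> 0"
    and "\<And>k l. k \<in> K \<Longrightarrow> l \<in> K \<Longrightarrow> \<chi> (k \<otimes> l) = \<chi> k * \<chi> l"
  shows "card (char_ext H K \<chi>) * card K = order H"
  using assms
proof (induction "order H - card K" arbitrary: K \<chi> rule: less_induct)
  case less
  note K = less.prems(1) and nz = less.prems(2) and mult = less.prems(3)
  have sub: "K \<subseteq> carrier H" by (rule subgroup.subset[OF K])
  note Kc = subsetD[OF sub] and K1 = subgroup.one_closed[OF K] and Km = subgroup.m_closed[OF K]
    and Ki = subgroup.m_inv_closed[OF K]
  show ?case
  proof (cases "K = carrier H")
    case True
    have "char_ext H K \<chi> = {restrict \<chi> (carrier H)}"
      using nz mult unfolding char_ext_def mem_character_group_iff True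
      by (auto simp: extensional_def fun_eq_iff)
    then show ?thesis by (simp add: True order_def)
  next
    case False
    then obtain g where g: "g \<in> carrier H" "g \<notin> K" using sub by blast
    \<comment> \<open>The order of the image of \<open>g\<close> in the quotient by
      \<open>K\<close>; the order of \<open>H\<close> shows that a suitable exponent exists.\<close>
    define n where "n = (LEAST n. n > 0 \<and> g [^] (n::nat) \<in> K)"
    have "order H > 0 \<and> g [^] order H \<in> K"
      using order_pos K1 g by (simp add: pow_order_eq_1)
    then have n: "n > 0" "g [^] n \<in> K" and n_le: "\<And>m. m > 0 \<Longrightarrow> g [^] m \<in> K \<Longrightarrow> n \<le> m"
      unfolding n_def by (metis (mono_tags, lifting) LeastI, metis (mono_tags, lifting) LeastI)
        (simp add: Least_le)
    have pw: "k [^] i \<in> K" "\<chi> (k [^] i) = \<chi> k ^ i" if "k \<in> K" for k and i :: nat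
      using multiplicative_pow[of K \<chi> k i] K nz mult that by auto
    have split: "g [^] i = (g [^] n) [^] (i div n) \<otimes> g [^] (i mod n)" for i
      using g by (simp add: nat_pow_pow nat_pow_mult)
    \<comment> \<open>Division with remainder: the power of \<open>g\<close> with exponent i mod n
      also lies in \<open>K\<close>, and minimality of \<open>n\<close> forces the remainder
      0.\<close>
    have dvd: "n dvd i" if "g [^] i \<in> K" for i
    proof -
      have "g [^] (i mod n) = inv ((g [^] n) [^] (i div n)) \<otimes> g [^] i"
        using g by (subst split) (simp add: m_assoc[symmetric])
      then have "g [^] (i mod n) \<in> K" using pw(1)[OF n(2)] that by (simp add: Km Ki)
      then have "i mod n = 0" using n_le[of "i mod n"] mod_less_divisor[OF n(1), of i] by linarith
      then show ?thesis by (simp add: dvd_eq_mod_eq_0)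
    qed
    \<comment> \<open>All coincidences among the products k g^i come from g^n lying in
      \<open>K\<close>. Unique representation in \<open>K'\<close> and well-definedness of
      \<open>\<psi>\<close> both rest on this.\<close>
    have collide: "\<exists>q. j = i + n * q \<and> k = l \<otimes> (g [^] n) [^] q"
      if "k \<in> K" "l \<in> K" "k \<otimes> g [^] i = l \<otimes> g [^] j" "i \<le> j" for k l i j
    proof -
      have "k \<otimes> g [^] i = (l \<otimes> g [^] (j - i)) \<otimes> g [^] i"
        using that g Kc by (simp add: m_assoc nat_pow_mult)
      then have k: "k = l \<otimes> g [^] (j - i)" using that g Kc by simp
      then have "g [^] (j - i) = inv l \<otimes> k" using that g Kc by (simp add: m_assoc[symmetric])
      then have "g [^] (j - i) \<in> K" using that by (simp add: Km Ki)
      then obtain q where "j - i = n * q" using dvd by blast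
      then show ?thesis using k that(4) g by (intro exI[of _ q]) (auto simp: nat_pow_pow)
    qed
    define K' where "K' = {k \<otimes> g [^] (i::nat) |k i. k \<in> K}"
    have K'I: "k \<otimes> g [^] (i::nat) \<in> K'" if "k \<in> K" for k i using that by (auto simp: K'_def)
    have K': "subgroup K' H"
    proof (rule subgroupI)
      show "K' \<subseteq> carrier H" using Kc g by (auto simp: K'_def)
      show "K' \<noteq> {}" using K1 by (auto simp: K'_def)
      show "inv a \<in> K'" if "a \<in> K'" for a
      proof -
        from that obtain k i where a: "k \<in> K" "a = k \<otimes> g [^] (i::nat)" by (auto simp: K'_def)
        \<comment> \<open>Elements of \<open>K'\<close> use natural exponents, so the inverse of g^i
          is rewritten as a positive power by means of g^|H| = 1.\<close>
        have "g [^] (i * (order H - 1)) \<otimes> g [^] i = g [^] (i * (order H - 1) + i)"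
          using g by (simp add: nat_pow_mult)
        also have "i * (order H - 1) + i = order H * i"
          using order_pos by (cases "order H") auto
        also have "g [^] (order H * i) = \<one>"
          using g by (simp add: nat_pow_pow[symmetric] pow_order_eq_1)
        finally have "inv (g [^] i) = g [^] (i * (order H - 1))"
          using g by (intro inv_equality) auto
        then have "inv a = inv k \<otimes> g [^] (i * (order H - 1))"
          using a g Kc by (simp add: inv_mult)
        then show ?thesis using a Ki K'I by simp
      qed
      show "a \<otimes> b \<in> K'" if "a \<in> K'" "b \<in> K'" for a b
      proof -
        obtain k i where a: "k \<in> K" "a = k \<otimes> g [^] (i::nat)" using \<open>a \<in> K'\<close> by (auto simp: K'_def)
        obtain l j where b: "l \<in> K" "b = l \<otimes> g [^] (j::nat)" using \<open>b \<in> K'\<close> by (auto simp: K'_def)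
        have "a \<otimes> b = (k \<otimes> l) \<otimes> (g [^] i \<otimes> g [^] j)" using a b g Kc by (simp add: m_ac)
        then show ?thesis using a b g Km K'I by (simp add: nat_pow_mult)
      qed
    qed
    \<comment> \<open>Each element of \<open>K'\<close> is k g^i for exactly one k in
      \<open>K\<close> and one i below \<open>n\<close>.\<close>
    have card_K': "card K' = n * card K"
    proof -
      have "inj_on (\<lambda>(k, i). k \<otimes> g [^] i) (K \<times> {..<n})"
      proof -
        have "k = l \<and> i = j" if "k \<in> K" "l \<in> K" "i < n" "j < n" "k \<otimes> g [^] i = l \<otimes> g [^] j" "i \<le> j" for k l i j
        proof -
          from collide that obtain q where "j = i + n * q" "k = l \<otimes> (g [^] n) [^] q" by blast
          then show ?thesis using that Kc by (cases q) auto
        qed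
        then show ?thesis by (auto simp: inj_on_def) (metis nle_le)+
      qed
      moreover have "(\<lambda>(k, i). k \<otimes> g [^] i) ` (K \<times> {..<n}) = K'"
      proof -
        have "k \<otimes> g [^] i \<in> (\<lambda>(k, i). k \<otimes> g [^] i) ` (K \<times> {..<n})" if "k \<in> K" for k and i :: nat
        proof (rule image_eqI)
          show "k \<otimes> g [^] i = (\<lambda>(k, i). k \<otimes> g [^] i) (k \<otimes> (g [^] n) [^] (i div n), i mod n)"
            using that g Kc by (subst split) (simp add: m_assoc)
        qed (use that n pw(1)[OF n(2)] Km in auto)
        then show ?thesis by (auto simp: K'_def)
      qed
      ultimately show ?thesis by (metis card_cartesian_product card_image card_lessThan mult.commute)
    qed
    define Z where "Z = {z. z ^ n = \<chi> (g [^] n)}"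
    \<comment> \<open>The extension to \<open>K'\<close> with value \<open>z\<close> at
      \<open>g\<close>. The chosen representation k g^i does not matter because z^n is the value of
      \<open>\<chi>\<close> at g^n.\<close>
    define \<psi> where "\<psi> = (\<lambda>z y. SOME c. \<exists>k\<in>K. \<exists>i::nat. y = k \<otimes> g [^] i \<and> c = \<chi> k * z ^ i)"
    have Z: "card Z = n" "finite Z"
      using card_nth_roots[OF nz[OF n(2)] n(1)] n(1) card_ge_0_finite[of Z] by (auto simp: Z_def)
    have \<psi>: "\<psi> z (k \<otimes> g [^] i) = \<chi> k * z ^ i" if z: "z \<in> Z" and k: "k \<in> K" for z k and i :: nat
    proof -
      have eq: "\<chi> k * z ^ i = \<chi> l * z ^ j" if "k \<in> K" "l \<in> K" "k \<otimes> g [^] i = l \<otimes> g [^] j" "i \<le> j" for k l i j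
      proof -
        from collide that obtain q where "j = i + n * q" "k = l \<otimes> (g [^] n) [^] q" by blast
        then show ?thesis using that z pw[OF n(2)] mult by (simp add: Z_def power_add power_mult)
      qed
      show ?thesis
        unfolding \<psi>_def
      proof (rule some_equality)
        fix c assume "\<exists>l\<in>K. \<exists>j::nat. k \<otimes> g [^] i = l \<otimes> g [^] j \<and> c = \<chi> l * z ^ j"
        then obtain l j where "l \<in> K" "k \<otimes> g [^] i = l \<otimes> g [^] (j::nat)" "c = \<chi> l * z ^ j" by blast
        then show "c = \<chi> k * z ^ i" using eq[of k l i j] eq[of l k j i] k by (metis nle_le)
      qed (use k in blast)
    qed
    have Z_nz: "z \<noteq> 0" if "z \<in> Z" for z
      using that n(1) nz[OF n(2)] by (auto simp: Z_def zero_power)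
    have card_ext: "card (char_ext H K' (\<psi> z)) * card K' = order H" if z: "z \<in> Z" for z
    proof (rule less.hyps[OF _ K'])
      have "card K > 0" by (rule card_subgroup_pos[OF K])
      \<comment> \<open>As \<open>g\<close> itself is outside \<open>K\<close>, the index
        \<open>n\<close> is at least 2 and \<open>K'\<close> is strictly larger than
        \<open>K\<close>.\<close>
      moreover have "n \<noteq> 1" using n g by auto
      ultimately have "card K < card K'" using n(1) by (simp add: card_K')
      moreover have "card K' \<le> order H"
        unfolding order_def by (intro card_mono finite_carrier subgroup.subset[OF K'])
      ultimately show "order H - card K' < order H - card K" by linarith
      show "\<psi> z a \<noteq> 0" if "a \<in> K'" for a
        using that z Z_nz nz by (auto simp: K'_def \<psi>)
      show "\<psi> z (a \<otimes> b) = \<psi> z a * \<psi> z b" if "a \<in> K'" "b \<in> K'" for a b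
      proof -
        obtain k i where a: "k \<in> K" "a = k \<otimes> g [^] (i::nat)" using \<open>a \<in> K'\<close> by (auto simp: K'_def)
        obtain l j where b: "l \<in> K" "b = l \<otimes> g [^] (j::nat)" using \<open>b \<in> K'\<close> by (auto simp: K'_def)
        have "a \<otimes> b = (k \<otimes> l) \<otimes> g [^] (i + j)" using a b g Kc by (simp add: nat_pow_mult[symmetric] m_ac)
        then have "\<psi> z (a \<otimes> b) = \<chi> (k \<otimes> l) * z ^ (i + j)" using \<psi>[OF z] a b Km by simp
        then show ?thesis using a b z by (simp add: \<psi> mult power_add)
      qed
    qed
    \<comment> \<open>Extensions are sorted by their value at \<open>g\<close>, whose n-th power is
      prescribed and which therefore lies in \<open>Z\<close>.\<close>
    have Un: "char_ext H K \<chi> = (\<Union>z\<in>Z. char_ext H K' (\<psi> z))"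
    proof (intro equalityI subsetI)
      fix \<alpha> assume "\<alpha> \<in> char_ext H K \<chi>"
      then have \<alpha>: "\<alpha> \<in> carrier (character_group H)" "\<And>k. k \<in> K \<Longrightarrow> \<alpha> k = \<chi> k"
        by (auto simp: char_ext_def)
      have z: "\<alpha> g \<in> Z" using character_pow[OF \<alpha>(1) g(1), of n] \<alpha>(2)[OF n(2)] by (simp add: Z_def)
      have "\<alpha> (k \<otimes> g [^] i) = \<psi> (\<alpha> g) (k \<otimes> g [^] i)" if "k \<in> K" for k and i :: nat
        using \<alpha> that g Kc \<psi>[OF z that] character_pow[OF \<alpha>(1) g(1)]
        by (simp add: mem_character_group_iff)
      then have "\<alpha> \<in> char_ext H K' (\<psi> (\<alpha> g))" using \<alpha>(1) by (auto simp: char_ext_def K'_def)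
      then show "\<alpha> \<in> (\<Union>z\<in>Z. char_ext H K' (\<psi> z))" using z by blast
    next
      fix \<alpha> assume "\<alpha> \<in> (\<Union>z\<in>Z. char_ext H K' (\<psi> z))"
      then obtain z where z: "z \<in> Z" and \<alpha>: "\<alpha> \<in> carrier (character_group H)" "\<And>a. a \<in> K' \<Longrightarrow> \<alpha> a = \<psi> z a"
        by (auto simp: char_ext_def)
      have "\<alpha> k = \<chi> k" if "k \<in> K" for k
        using \<alpha>(2)[OF K'I[OF that, of 0]] \<psi>[OF z that, of 0] that Kc by simp
      then show "\<alpha> \<in> char_ext H K \<chi>" using \<alpha>(1) by (simp add: char_ext_def)
    qed
    have \<chi>1: "\<chi> \<one> = 1"
      using pw(2)[OF K1, of 0] by simp
    have val_g: "\<alpha> g = z" if "z \<in> Z" "\<alpha> \<in> char_ext H K' (\<psi> z)" for \<alpha> z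
      using that K'I[OF K1, of 1] \<psi>[OF that(1) K1, of 1] g \<chi>1 by (auto simp: char_ext_def)
    have "card (char_ext H K \<chi>) = (\<Sum>z\<in>Z. card (char_ext H K' (\<psi> z)))"
      unfolding Un
    proof (rule card_UN_disjoint)
      \<comment> \<open>An infinite set has \<open>card\<close> 0, contradicting the product formula
        \<open>card_ext\<close> because |H| is positive.\<close>
      show "\<forall>z\<in>Z. finite (char_ext H K' (\<psi> z))"
        using card_ext order_pos by (metis card.infinite mult_zero_left less_numeral_extra(3))
      show "\<forall>i\<in>Z. \<forall>j\<in>Z. i \<noteq> j \<longrightarrow> char_ext H K' (\<psi> i) \<inter> char_ext H K' (\<psi> j) = {}"
        using val_g by blast
    qed (rule Z)
    then have "card (char_ext H K \<chi>) * card K' = (\<Sum>z\<in>Z. card (char_ext H K' (\<psi> z)) * card K')"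
      by (simp add: sum_distrib_right)
    also have "\<dots> = n * order H" using Z by (simp add: card_ext)
    finally show ?thesis using n by (simp add: card_K')
  qed
qed

section \<open>Orders of the character group, of dual subgroups and of their intersections\<close>

lemma card_dual_subgroup: "subgroup K H \<Longrightarrow> card (dual_subgroup H K) * card K = order H"
  unfolding dual_subgroup_eq_char_ext by (rule card_char_ext) auto

lemma dual_subgroup_triv: "dual_subgroup H {\<one>} = carrier (character_group H)"
  by (auto simp: dual_subgroup_def character_one)

lemma order_character_group: "order (character_group H) = order H"
  using card_dual_subgroup[OF triv_subgroup] unfolding dual_subgroup_triv by (simp add: order_def)

lemma character_group_finite_comm_group: "finite_comm_group (character_group H)"
proof -
  have [simp]: "\<one>\<^bsub>character_group H\<^esub> = (\<lambda>g\<in>carrier H. 1)"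
    "\<alpha> \<otimes>\<^bsub>character_group H\<^esub> \<beta> = (\<lambda>g\<in>carrier H. \<alpha> g * \<beta> g)" for \<alpha> \<beta>
    by (simp_all add: character_group_def)
  have "comm_group (character_group H)"
  proof (rule comm_groupI)
    fix \<alpha> assume \<alpha>: "\<alpha> \<in> carrier (character_group H)"
    show "\<exists>\<beta>\<in>carrier (character_group H). \<beta> \<otimes>\<^bsub>character_group H\<^esub> \<alpha> = \<one>\<^bsub>character_group H\<^esub>"
      using \<alpha> by (intro bexI[of _ "\<lambda>g\<in>carrier H. inverse (\<alpha> g)"])
        (auto simp: mem_character_group_iff extensional_def restrict_def fun_eq_iff)
    show "\<one>\<^bsub>character_group H\<^esub> \<otimes>\<^bsub>character_group H\<^esub> \<alpha> = \<alpha>"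
      using \<alpha> by (auto simp: mem_character_group_iff extensional_def restrict_def fun_eq_iff)
  qed (auto simp: mem_character_group_iff extensional_def restrict_def fun_eq_iff)
  moreover have "finite (carrier (character_group H))"
    using order_character_group order_pos by (metis card_gt_0_iff order_def)
  ultimately show ?thesis by (simp add: finite_comm_group_def finite_comm_group_axioms_def)
qed

lemma subgroup_dual_subgroup:
  assumes "K \<subseteq> carrier H"
  shows "subgroup (dual_subgroup H K) (character_group H)"
proof -
  interpret D: finite_comm_group "character_group H" by (rule character_group_finite_comm_group)
  have mult: "(\<alpha> \<otimes>\<^bsub>character_group H\<^esub> \<beta>) k = \<alpha> k * \<beta> k" if "k \<in> K" for \<alpha> \<beta> k
    using that assms by (auto simp: character_group_def)
  have one: "\<one>\<^bsub>character_group H\<^esub> k = 1" if "k \<in> K" for k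
    using that assms by (auto simp: character_group_def)
  show ?thesis
  proof (rule D.subgroupI)
    show "dual_subgroup H K \<subseteq> carrier (character_group H)" by (auto simp: dual_subgroup_def)
    show "dual_subgroup H K \<noteq> {}" using one D.one_closed by (auto simp: dual_subgroup_def)
    show "inv\<^bsub>character_group H\<^esub> \<alpha> \<in> dual_subgroup H K" if "\<alpha> \<in> dual_subgroup H K" for \<alpha>
    proof -
      have "\<alpha> \<in> carrier (character_group H)" using that by (simp add: dual_subgroup_def)
      then have "(inv\<^bsub>character_group H\<^esub> \<alpha>) k * \<alpha> k = 1" if "k \<in> K" for k
        using mult[OF that, of "inv\<^bsub>character_group H\<^esub> \<alpha>" \<alpha>] one[OF that] by simp
      then show ?thesis using that by (auto simp: dual_subgroup_def)
    qed
  qed (auto simp: dual_subgroup_def mult)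
qed

text \<open>The product map from pairs in K and L onto K L has fibres of size |K \<inter> L|: from
  one pair (k, l) all others with the same product arise as (k t, t^-1 l) with t in the
  intersection.\<close>

lemma card_set_mult:
  assumes K: "subgroup K H" and L: "subgroup L H"
  shows "card (K <#> L) * card (K \<inter> L) = card K * card L"
proof -
  note Kc = subgroup.mem_carrier[OF K] and Lc = subgroup.mem_carrier[OF L]
  have fibre: "card {p \<in> K \<times> L. fst p \<otimes> snd p = y} = card (K \<inter> L)" if "y \<in> K <#> L" for y
  proof -
    from that obtain k l where kl: "k \<in> K" "l \<in> L" "y = k \<otimes> l" by (auto simp: set_mult_def)
    have "bij_betw (\<lambda>t. (k \<otimes> t, inv t \<otimes> l)) (K \<inter> L) {p \<in> K \<times> L. fst p \<otimes> snd p = y}"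
    proof (rule bij_betw_byWitness[where f' = "\<lambda>p. inv k \<otimes> fst p"])
      show "\<forall>t\<in>K \<inter> L. inv k \<otimes> fst (k \<otimes> t, inv t \<otimes> l) = t"
        using kl Kc by (simp add: m_assoc[symmetric])
      show "\<forall>p\<in>{p \<in> K \<times> L. fst p \<otimes> snd p = y}. (k \<otimes> (inv k \<otimes> fst p), inv (inv k \<otimes> fst p) \<otimes> l) = p"
      proof
        fix p assume "p \<in> {p \<in> K \<times> L. fst p \<otimes> snd p = y}"
        then obtain a b where ab: "a \<in> K" "b \<in> L" "a \<otimes> b = y" and p: "p = (a, b)" by (cases p) auto
        have "inv (inv k \<otimes> a) \<otimes> l = inv a \<otimes> (k \<otimes> l)"
          using ab kl Kc Lc by (simp add: inv_mult m_ac)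
        also have "\<dots> = inv a \<otimes> (a \<otimes> b)" using ab kl by simp
        also have "\<dots> = b" using ab(1,2) Kc Lc by (simp add: m_assoc[symmetric])
        finally show "(k \<otimes> (inv k \<otimes> fst p), inv (inv k \<otimes> fst p) \<otimes> l) = p"
          using ab kl Kc p by (simp add: m_assoc[symmetric])
      qed
      show "(\<lambda>t. (k \<otimes> t, inv t \<otimes> l)) ` (K \<inter> L) \<subseteq> {p \<in> K \<times> L. fst p \<otimes> snd p = y}"
      proof
        fix p assume "p \<in> (\<lambda>t. (k \<otimes> t, inv t \<otimes> l)) ` (K \<inter> L)"
        then obtain t where t: "t \<in> K" "t \<in> L" and p: "p = (k \<otimes> t, inv t \<otimes> l)" by blast
        have "k \<otimes> t \<in> K" "inv t \<otimes> l \<in> L"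
          using t kl K L by (auto intro: subgroup.m_closed subgroup.m_inv_closed)
        moreover have "t \<otimes> (inv t \<otimes> l) = l"
          using t kl Kc Lc by (simp add: m_assoc[symmetric])
        then have "(k \<otimes> t) \<otimes> (inv t \<otimes> l) = k \<otimes> l"
          using t kl Kc Lc by (simp add: m_assoc)
        then have "fst p \<otimes> snd p = y" using kl p by simp
        ultimately show "p \<in> {p \<in> K \<times> L. fst p \<otimes> snd p = y}" using p by simp
      qed
      show "(\<lambda>p. inv k \<otimes> fst p) ` {p \<in> K \<times> L. fst p \<otimes> snd p = y} \<subseteq> K \<inter> L"
      proof
        fix c assume "c \<in> (\<lambda>p. inv k \<otimes> fst p) ` {p \<in> K \<times> L. fst p \<otimes> snd p = y}"
        then obtain a b where ab: "a \<in> K" "b \<in> L" "a \<otimes> b = y" and c: "c = inv k \<otimes> a" by auto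
        \<comment> \<open>From a b = k l follows k^-1 a = l b^-1; the left form shows membership in
          \<open>K\<close>, the right form in \<open>L\<close>.\<close>
        have "(a \<otimes> b) \<otimes> inv b = a" using ab(1,2) Kc Lc by (simp add: m_assoc)
        then have "(k \<otimes> l) \<otimes> inv b = a" using ab(3) kl(3) by simp
        moreover have "inv k \<otimes> ((k \<otimes> l) \<otimes> inv b) = l \<otimes> inv b"
          using ab(2) kl(1,2) Kc Lc by (simp add: m_assoc[symmetric])
        ultimately have "inv k \<otimes> a = l \<otimes> inv b" by simp
        then have "c \<in> L"
          using ab kl L c by (auto intro: subgroup.m_closed subgroup.m_inv_closed)
        moreover have "c \<in> K"
          using ab kl K c by (auto intro: subgroup.m_closed subgroup.m_inv_closed)
        ultimately show "c \<in> K \<inter> L" by blast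
      qed
    qed
    then show ?thesis by (simp add: bij_betw_same_card)
  qed
  have "card (K \<times> L) = (\<Sum>p\<in>K \<times> L. 1)" by simp
  also have "\<dots> = (\<Sum>y\<in>(\<lambda>p. fst p \<otimes> snd p) ` (K \<times> L). \<Sum>p | p \<in> K \<times> L \<and> fst p \<otimes> snd p = y. 1)"
    using finite_subgroup K L by (intro sum.image_gen) auto
  also have "(\<lambda>p. fst p \<otimes> snd p) ` (K \<times> L) = K <#> L"
    by (force simp: set_mult_def)
  also have "(\<Sum>y\<in>K <#> L. \<Sum>p | p \<in> K \<times> L \<and> fst p \<otimes> snd p = y. 1) =
      (\<Sum>y\<in>K <#> L. card (K \<inter> L))"
    by (intro sum.cong refl) (simp only: card_eq_sum[symmetric] fibre)
  also have "\<dots> = card (K <#> L) * card (K \<inter> L)" by simp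
  finally show ?thesis by (simp add: card_cartesian_product)
qed

lemma dual_subgroup_Int:
  assumes K: "subgroup K H" and L: "subgroup L H"
  shows "dual_subgroup H K \<inter> dual_subgroup H L = dual_subgroup H (K <#> L)"
proof (intro equalityI subsetI)
  fix \<alpha> assume "\<alpha> \<in> dual_subgroup H K \<inter> dual_subgroup H L"
  then show "\<alpha> \<in> dual_subgroup H (K <#> L)"
    using subgroup.mem_carrier[OF K] subgroup.mem_carrier[OF L]
    by (auto simp: dual_subgroup_def mem_character_group_iff set_mult_def)
next
  fix \<alpha> assume \<alpha>: "\<alpha> \<in> dual_subgroup H (K <#> L)"
  have "k \<in> K <#> L" if "k \<in> K" for k
    using that subgroup.one_closed[OF L] subgroup.mem_carrier[OF K] by (force simp: set_mult_def)
  moreover have "l \<in> K <#> L" if "l \<in> L" for l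
    using that subgroup.one_closed[OF K] subgroup.mem_carrier[OF L] by (force simp: set_mult_def)
  ultimately show "\<alpha> \<in> dual_subgroup H K \<inter> dual_subgroup H L"
    using \<alpha> by (auto simp: dual_subgroup_def)
qed

text \<open>The intersection is the dual of K L, of order |H| / |K L|, and |K L| = |K| |L| / |K
  \<inter> L|. Multiplied out, the identity stays within the natural numbers.\<close>

lemma card_dual_subgroup_Int:
  assumes K: "subgroup K H" and L: "subgroup L H"
  shows "card (dual_subgroup H K \<inter> dual_subgroup H L) * (card K * card L) = order H * card (K \<inter> L)"
  using card_dual_subgroup[OF mult_subgroups[OF K L]] card_set_mult[OF K L]
  unfolding dual_subgroup_Int[OF K L] by (metis mult.assoc)

end

section \<open>Saito duality\<close>

text \<open>Saito duality on the level of sets: every orbit of type \<open>H / K\<close> is replaced by one copy of the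
  coset space of the dual subgroup of \<open>K\<close>.\<close>

definition dual_gset :: "('g, 'm) monoid_scheme \<Rightarrow> ('g, 'x) gset \<Rightarrow> ('g \<Rightarrow> complex, 'x \<times> ('g \<Rightarrow> complex) set) gset" where
  "dual_gset H S =
     (let X = (SIGMA r:orbit_reps H S.
                 lcosets\<^bsub>character_group H\<^esub> (dual_subgroup H (stabilizer H (snd S) r)))
      in (X, \<lambda>\<alpha>. \<lambda>p\<in>X. (fst p, \<alpha> <#\<^bsub>character_group H\<^esub> snd p)))"

section \<open>Coset spaces and their duals as sets with an action\<close>

context finite_comm_group
begin

context
  fixes K assumes K: "subgroup K H"
begin

text \<open>The action laws of a coset space. The last item uses commutativity: the stabilizer of a
  K is the conjugate a K a^-1, which is \<open>K\<close>.\<close>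

lemma lcoset_translate:
  assumes "C \<in> lcosets K"
  shows "g \<in> carrier H \<Longrightarrow> g <# C \<in> lcosets K"
    and "\<one> <# C = C"
    and "g \<in> carrier H \<Longrightarrow> h \<in> carrier H \<Longrightarrow> (g \<otimes> h) <# C = g <# (h <# C)"
    and "{g \<in> carrier H. g <# C = C} = K"
proof -
  obtain a where a: "a \<in> carrier H" "C = a <# K" using assms by (auto simp: LCOSETS_def)
  have sub: "K \<subseteq> carrier H" "C \<subseteq> carrier H"
    using subgroup.subset[OF K] a l_coset_subset_G by auto
  show "g \<in> carrier H \<Longrightarrow> g <# C \<in> lcosets K"
    using a sub by (auto simp: LCOSETS_def lcos_m_assoc)
  show "\<one> <# C = C" using sub by (simp add: lcos_mult_one)
  show "g \<in> carrier H \<Longrightarrow> h \<in> carrier H \<Longrightarrow> (g \<otimes> h) <# C = g <# (h <# C)"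
    using sub by (simp add: lcos_m_assoc)
  have "g <# C = C \<longleftrightarrow> g \<in> K" if g: "g \<in> carrier H" for g
  proof
    assume "g <# C = C"
    moreover have "a \<in> C" using a lcos_self K by simp
    ultimately have "g \<otimes> a \<in> a <# K" using a(2) unfolding l_coset_def by blast
    then obtain k where "k \<in> K" "g \<otimes> a = a \<otimes> k" by (auto simp: l_coset_def)
    then show "g \<in> K" using a g subgroup.mem_carrier[OF K] m_comm[of a k] by simp
  next
    assume "g \<in> K"
    then have "a \<otimes> g \<in> a <# K" by (auto simp: l_coset_def)
    then have "a <# K = (a \<otimes> g) <# K" using a K by (intro l_repr_independence) auto
    also have "\<dots> = g <# (a <# K)" using a(1) g sub(1) by (simp add: lcos_m_assoc m_comm)
    finally show "g <# C = C" by (simp add: a(2))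
  qed
  then show "{g \<in> carrier H. g <# C = C} = K" using sub by auto
qed

lemma card_lcosets: "of_nat (card (lcosets K)) = (of_nat (order H) / of_nat (card K) :: rat)"
  using l_lagrange[OF finite_carrier K] card_subgroup_pos[OF K]
  by (simp add: field_simps flip: of_nat_mult)

lemma finite_lcosets: "finite (lcosets K)"
  using finite_carrier by (simp add: LCOSETS_def)

lemma finite_gset_cosets: "finite_gset H (gset_cosets H K)"
  unfolding gset_cosets_def
  using finite_lcosets lcoset_translate by (intro finite_gsetI) (auto simp: is_group)

lemma stab_sum_cosets:
  "stab_sum H (gset_cosets H K) f = of_nat (order H) / of_nat (card K) * f K"
proof -
  have "stabilizer H (snd (gset_cosets H K)) C = K" if "C \<in> lcosets K" for C
    using that lcoset_translate(4)[OF that] by (simp add: stabilizer_def gset_cosets_def)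
  then show ?thesis by (simp add: stab_sum_def gset_cosets_def card_lcosets)
qed

end

text \<open>An orbit with stabilizer K becomes |H| / |K~| = |K| points, all with stabilizer K~.
  Spreading this |K| over the points of the old orbit multiplies it by |K| / |H| and gives
  \<open>euler_weight\<close>.\<close>

lemma
  assumes S: "finite_gset H S"
  shows finite_gset_dual: "finite_gset (character_group H) (dual_gset H S)"
    and stab_sum_dual: "stab_sum (character_group H) (dual_gset H S) f =
      stab_sum H S (\<lambda>K. euler_weight H K * f (dual_subgroup H K))"
proof -
  interpret D: finite_comm_group "character_group H" by (rule character_group_finite_comm_group)
  let ?K = "\<lambda>r. stabilizer H (snd S) r"
  let ?D = "\<lambda>r. dual_subgroup H (?K r)"
  define X where "X = (SIGMA r:orbit_reps H S. lcosets\<^bsub>character_group H\<^esub> (?D r))"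
  have dual: "dual_gset H S = (X, \<lambda>\<alpha>. \<lambda>p\<in>X. (fst p, \<alpha> <#\<^bsub>character_group H\<^esub> snd p))"
    by (simp add: dual_gset_def X_def Let_def)
  have sub: "subgroup (?D r) (character_group H)" for r
    by (rule subgroup_dual_subgroup) (auto simp: stabilizer_def)
  have fin: "finite (orbit_reps H S)"
    using orbit_reps_subset[OF S] gset_finite[OF S] by (rule finite_subset)
  show "finite_gset (character_group H) (dual_gset H S)"
    unfolding dual
  proof (rule finite_gsetI)
    show "finite X" unfolding X_def using fin D.finite_lcosets[OF sub] by blast
  qed (use D.lcoset_translate[OF sub] D.is_group in \<open>auto simp: X_def\<close>)
  have stab: "stabilizer (character_group H) (snd (dual_gset H S)) (r, C) = ?D r" if "(r, C) \<in> X" for r C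
    using that D.lcoset_translate(4)[OF sub] by (auto simp: dual stabilizer_def X_def)
  have "stab_sum (character_group H) (dual_gset H S) f = (\<Sum>(r, C)\<in>X. f (?D r))"
    unfolding stab_sum_def dual fst_conv by (intro sum.cong refl) (use stab dual in auto)
  also have "\<dots> = (\<Sum>r\<in>orbit_reps H S. of_nat (card (lcosets\<^bsub>character_group H\<^esub> (?D r))) * f (?D r))"
    unfolding X_def using fin D.finite_lcosets[OF sub] by (subst sum.Sigma[symmetric]) auto
  also have "\<dots> = (\<Sum>r\<in>orbit_reps H S. of_nat (card (?K r)) * f (?D r))"
  proof (rule sum.cong[OF refl])
    fix r assume "r \<in> orbit_reps H S"
    then have "subgroup (?K r) H"
      using orbit_reps_subset[OF S] group_action.stabilizer_subgroup[OF gset_action[OF S]] by blast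
    then have "card (?D r) * card (?K r) = order H" by (rule card_dual_subgroup)
    then show "of_nat (card (lcosets\<^bsub>character_group H\<^esub> (?D r))) * f (?D r) = of_nat (card (?K r)) * f (?D r)"
      using D.card_subgroup_pos[OF sub, of r]
      by (simp add: D.card_lcosets[OF sub] order_character_group field_simps flip: of_nat_mult)
  qed
  also have "\<dots> = stab_sum H S (\<lambda>K. euler_weight H K * f (dual_subgroup H K))"
    by (simp add: sum_orbit_reps[OF S, of "\<lambda>K. of_nat (card K) * f (dual_subgroup H K)"]
        euler_weight_def power2_eq_square mult.assoc)
  finally show "stab_sum (character_group H) (dual_gset H S) f =
      stab_sum H S (\<lambda>K. euler_weight H K * f (dual_subgroup H K))" .
qed

lemma
  assumes S: "finite_gset H S"
  shows burnside_class_closed: "burnside_class H S \<in> carrier (burnside_ring H)"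
    and burnside_val_class: "burnside_val H (burnside_class H S) f = stab_sum H S f"
  using burnside_diff_closed[OF S finite_gset_empty] burnside_val_diff[OF S finite_gset_empty]
  by (simp_all add: burnside_class_def is_group)

lemma burnside_hom_add:
  assumes "D \<in> hom (add_monoid (burnside_ring H)) (add_monoid (burnside_ring H'))"
    and "finite_comm_group H'"
    and "a \<in> carrier (burnside_ring H)" "b \<in> carrier (burnside_ring H)"
  shows "burnside_val H' (D (a \<oplus>\<^bsub>burnside_ring H\<^esub> b)) f = burnside_val H' (D a) f + burnside_val H' (D b) f"
  using assms finite_comm_group.burnside_val_add[OF assms(2), of "D a" "D b"]
  by (auto simp: hom_def Pi_iff)

text \<open>The condition under the definite description in \<open>saito_duality\<close>, named so
  that existence and uniqueness can be proved separately.\<close>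

definition is_saito_hom where
  "is_saito_hom D \<longleftrightarrow>
    D \<in> hom (add_monoid (burnside_ring H)) (add_monoid (burnside_ring (character_group H))) \<and>
    D \<in> extensional (carrier (burnside_ring H)) \<and>
    (\<forall>K. subgroup K H \<longrightarrow> D (burnside_class H (gset_cosets H K)) =
      burnside_class (character_group H) (gset_cosets (character_group H) (dual_subgroup H K)))"

text \<open>The factors before \<open>f\<close> multiply to |K|, the number of points of the dual
  coset space. They are kept in the form that \<open>stab_sum_cosets\<close> gives for H/K, ready
  for comparison.\<close>

lemma burnside_val_dual_cosets:
  assumes K: "subgroup K H"
  shows "burnside_val (character_group H)
      (burnside_class (character_group H) (gset_cosets (character_group H) (dual_subgroup H K))) f =
    of_nat (order H) / of_nat (card K) * (euler_weight H K * f (dual_subgroup H K))"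
proof -
  interpret D: finite_comm_group "character_group H" by (rule character_group_finite_comm_group)
  have sub: "subgroup (dual_subgroup H K) (character_group H)"
    by (rule subgroup_dual_subgroup[OF subgroup.subset[OF K]])
  have "of_nat (card (dual_subgroup H K)) * of_nat (card K) = (of_nat (order H) :: rat)"
    by (simp add: card_dual_subgroup[OF K] flip: of_nat_mult)
  then show ?thesis
    using D.card_subgroup_pos[OF sub] card_subgroup_pos[OF K] order_pos
    by (simp add: D.burnside_val_class D.finite_gset_cosets[OF sub] D.stab_sum_cosets[OF sub]
        order_character_group euler_weight_def power2_eq_square field_simps)
qed

text \<open>Uniqueness of the duality: splitting off one orbit after the other shows that the values on coset
  spaces determine the homomorphism.\<close>

lemma saito_hom_val:
  assumes D: "is_saito_hom D" and a: "a \<in> carrier (burnside_ring H)"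
  shows "burnside_val (character_group H) (D a) f =
    burnside_val H a (\<lambda>K. euler_weight H K * f (dual_subgroup H K))"
proof -
  interpret C: finite_comm_group "character_group H" by (rule character_group_finite_comm_group)
  let ?f = "\<lambda>K. euler_weight H K * f (dual_subgroup H K)"
  note add = burnside_hom_add[OF D[unfolded is_saito_hom_def, THEN conjunct1] C.finite_comm_group_axioms]
  have gset: "burnside_val (character_group H) (D (burnside_class H S)) f = stab_sum H S ?f"
    if "finite_gset H S" for S :: "('a, nat) gset"
    using that
  proof (induction "card (fst S)" arbitrary: S rule: less_induct)
    case less
    note S = less.prems
    note closed = burnside_class_closed[OF S]
    show ?case
    proof (cases "fst S = {}")
      case True
      then have zero: "stab_sum H S h = 0" for h by (simp add: stab_sum_def)
      \<comment> \<open>\<open>D\<close> is only known to respect sums, so its vanishing on the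
        class of the empty set is drawn from c + c = c.\<close>
      have "burnside_class H S \<oplus>\<^bsub>burnside_ring H\<^esub> burnside_class H S = burnside_class H S"
        using closed by (intro burnside_eqI) (simp_all add: burnside_add_closed burnside_val_add burnside_val_class S zero)
      then show ?thesis using add[OF closed closed, of f] zero by simp
    next
      case False
      then obtain x where x: "x \<in> fst S" by blast
      define K where "K = stabilizer H (snd S) x"
      have K: "subgroup K H"
        unfolding K_def by (rule group_action.stabilizer_subgroup[OF gset_action[OF S] x])
      define S' where "S' = gset_restrict S (fst S - orbit H (snd S) x)"
      have S': "finite_gset H S'" unfolding S'_def by (rule finite_gset_orbit_compl[OF S x])
      have "x \<in> orbit H (snd S) x" by (rule group_action.orbit_refl[OF gset_action[OF S] x])
      then have "card (fst S') < card (fst S)"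
        unfolding S'_def gset_restrict_def using x gset_finite[OF S] by (auto intro!: psubset_card_mono)
      then have IH: "burnside_val (character_group H) (D (burnside_class H S')) f = stab_sum H S' ?f"
        using S' by (rule less.hyps)
      \<comment> \<open>To every functional the orbit of \<open>x\<close> contributes the same as
        the coset space of its stabilizer.\<close>
      have split: "stab_sum H S h = stab_sum H (gset_cosets H K) h + stab_sum H S' h" for h
        by (simp add: stab_sum_restrict[OF S orbit_subset[OF S x]] S'_def stab_sum_orbit[OF S x]
            stab_sum_cosets[OF K] K_def[symmetric])
      have "burnside_class H S = burnside_class H (gset_cosets H K) \<oplus>\<^bsub>burnside_ring H\<^esub> burnside_class H S'"
        using S S' finite_gset_cosets[OF K]
        by (intro burnside_eqI)
          (simp_all add: burnside_add_closed burnside_class_closed burnside_val_add burnside_val_class split)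
      moreover have "burnside_val (character_group H) (D (burnside_class H (gset_cosets H K))) f =
          stab_sum H (gset_cosets H K) ?f"
        using D K by (simp add: is_saito_hom_def burnside_val_dual_cosets stab_sum_cosets)
      ultimately show ?thesis
        using add[of "burnside_class H (gset_cosets H K)" "burnside_class H S'"] S' finite_gset_cosets[OF K] IH
        by (simp add: burnside_class_closed split)
    qed
  qed
  obtain S T where ST: "(S, T) \<in> a" "finite_gset H S" "finite_gset H T" by (rule burnside_rep[OF a])
  have val: "burnside_val H a h = stab_sum H S h - stab_sum H T h" for h
    using ST(1) by (simp add: burnside_mem_iff[OF a])
  \<comment> \<open>Subtraction is avoided: a = [S] - [T] is used in the form a + [T] = [S], to
    which additivity applies.\<close>
  have "a \<oplus>\<^bsub>burnside_ring H\<^esub> burnside_class H T = burnside_class H S"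
    using a ST(2,3)
    by (intro burnside_eqI)
      (simp_all add: burnside_add_closed burnside_class_closed burnside_val_add burnside_val_class val)
  then have "stab_sum H S ?f = burnside_val (character_group H) (D a) f + stab_sum H T ?f"
    using add[OF a burnside_class_closed[OF ST(3)], of f] gset[OF ST(2)] gset[OF ST(3)] by simp
  then show ?thesis by (simp add: val)
qed

text \<open>Dualize both members of a chosen representing pair. By \<open>stab_sum_dual\<close> the
  functional of the result depends only on that of \<open>a\<close>, so the choice is harmless and
  additivity holds although the dual sets depend on representatives.\<close>

lemma ex_saito_hom: "\<exists>D. is_saito_hom D"
proof -
  interpret C: finite_comm_group "character_group H" by (rule character_group_finite_comm_group)
  define D where "D = (\<lambda>a\<in>carrier (burnside_ring H).
    let (S, T) = SOME p. p \<in> a in burnside_diff (character_group H) (dual_gset H S) (dual_gset H T))"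
  have D: "D a \<in> carrier (burnside_ring (character_group H)) \<and>
      (\<forall>f. burnside_val (character_group H) (D a) f =
        burnside_val H a (\<lambda>K. euler_weight H K * f (dual_subgroup H K)))"
    if a: "a \<in> carrier (burnside_ring H)" for a
  proof -
    obtain S T where some: "(SOME p. p \<in> a) = (S, T)" by (metis surj_pair)
    have "(SOME p. p \<in> a) \<in> a" using burnside_rep[OF a] by (metis someI)
    then have ST: "(S, T) \<in> a" by (simp add: some)
    then have fin: "finite_gset H S" "finite_gset H T"
      and val: "\<And>h. burnside_val H a h = stab_sum H S h - stab_sum H T h"
      unfolding burnside_mem_iff[OF a] by auto
    have "D a = burnside_diff (character_group H) (dual_gset H S) (dual_gset H T)"
      using a by (simp add: D_def some)
    then show ?thesis
      using finite_gset_dual[OF fin(1)] finite_gset_dual[OF fin(2)]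
      by (simp add: C.burnside_diff_closed C.burnside_val_diff stab_sum_dual fin val)
  qed
  have "D (a \<oplus>\<^bsub>burnside_ring H\<^esub> b) = D a \<oplus>\<^bsub>burnside_ring (character_group H)\<^esub> D b"
    if "a \<in> carrier (burnside_ring H)" "b \<in> carrier (burnside_ring H)" for a b
    using that D burnside_add_closed
    by (intro C.burnside_eqI) (simp_all add: C.burnside_add_closed C.burnside_val_add burnside_val_add)
  then have "D \<in> hom (add_monoid (burnside_ring H)) (add_monoid (burnside_ring (character_group H)))"
    using D by (intro homI) auto
  moreover have "D (burnside_class H (gset_cosets H K)) =
      burnside_class (character_group H) (gset_cosets (character_group H) (dual_subgroup H K))"
    if K: "subgroup K H" for K
    using D[OF burnside_class_closed[OF finite_gset_cosets[OF K]]]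
      C.burnside_class_closed[OF C.finite_gset_cosets[OF subgroup_dual_subgroup[OF subgroup.subset[OF K]]]]
    by (intro C.burnside_eqI)
      (simp_all add: burnside_val_dual_cosets[OF K] burnside_val_class finite_gset_cosets[OF K] stab_sum_cosets[OF K])
  ultimately show ?thesis unfolding is_saito_hom_def by (auto simp: D_def)
qed

text \<open>Two candidates agree on the carrier, since \<open>saito_hom_val\<close> fixes their
  functionals, and being extensional they agree everywhere.\<close>

lemma is_saito_hom_saito_duality: "is_saito_hom (saito_duality H)"
proof -
  interpret C: finite_comm_group "character_group H" by (rule character_group_finite_comm_group)
  have closed: "D a \<in> carrier (burnside_ring (character_group H))"
    if "is_saito_hom D" "a \<in> carrier (burnside_ring H)" for D a
  proof -
    have "D \<in> hom (add_monoid (burnside_ring H)) (add_monoid (burnside_ring (character_group H)))"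
      using that(1) unfolding is_saito_hom_def by blast
    from hom_in_carrier[OF this, of a] that(2) show ?thesis by simp
  qed
  have "D = E" if "is_saito_hom D" "is_saito_hom E" for D E
  proof (rule extensionalityI)
    show "D \<in> extensional (carrier (burnside_ring H))" "E \<in> extensional (carrier (burnside_ring H))"
      using that by (simp_all add: is_saito_hom_def)
    show "D a = E a" if "a \<in> carrier (burnside_ring H)" for a
      using that \<open>is_saito_hom D\<close> \<open>is_saito_hom E\<close> closed
      by (intro C.burnside_eqI) (simp_all add: saito_hom_val)
  qed
  then have "is_saito_hom (THE D. is_saito_hom D)"
    by (rule theI'[OF ex_ex1I[OF ex_saito_hom]])
  then show ?thesis unfolding saito_duality_def is_saito_hom_def .
qed

text \<open>Stabilizers are subgroups, so weights need to be compared on subgroups only; the duality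
  identity between weights is available just there.\<close>

lemma burnside_val_cong:
  assumes a: "a \<in> carrier (burnside_ring H)" and eq: "\<And>K. subgroup K H \<Longrightarrow> f K = h K"
  shows "burnside_val H a f = burnside_val H a h"
proof -
  have sum: "stab_sum H S f = stab_sum H S h" if S: "finite_gset H S" for S :: "('a, nat) gset"
    unfolding stab_sum_def
    by (intro sum.cong refl eq group_action.stabilizer_subgroup[OF gset_action[OF S]])
  obtain S T where "(S, T) \<in> a" "finite_gset H S" "finite_gset H T" by (rule burnside_rep[OF a])
  then show ?thesis unfolding burnside_mem_iff[OF a] by (metis sum)
qed

lemma of_int_orb_euler_red:
  assumes a: "a \<in> carrier (burnside_ring H)" and K: "subgroup K H"
  shows "of_int (orb_euler (H\<lparr>carrier := K\<rparr>) (burnside_red H K a)) =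
    burnside_val H a (\<lambda>L. euler_weight (H\<lparr>carrier := K\<rparr>) (L \<inter> K))"
  using finite_comm_group.of_int_orb_euler[OF subgroup_finite_comm_group[OF K] burnside_red_closed[OF a K]]
  by (simp add: burnside_val_red[OF a K])

text \<open>Additivity is checked after embedding the integers into the rationals, where the map
  evaluates the functional of a class at a fixed weight.\<close>

lemma orb_euler_red_hom:
  assumes K: "subgroup K H"
  shows "orb_euler (H\<lparr>carrier := K\<rparr>) \<circ> burnside_red H K \<in> hom (add_monoid (burnside_ring H)) integer_group"
proof (rule homI)
  fix a b assume "a \<in> carrier (add_monoid (burnside_ring H))" "b \<in> carrier (add_monoid (burnside_ring H))"
  then have ab: "a \<in> carrier (burnside_ring H)" "b \<in> carrier (burnside_ring H)" by simp_all
  have "of_int ((orb_euler (H\<lparr>carrier := K\<rparr>) \<circ> burnside_red H K) (a \<otimes>\<^bsub>add_monoid (burnside_ring H)\<^esub> b)) =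
    (of_int ((orb_euler (H\<lparr>carrier := K\<rparr>) \<circ> burnside_red H K) a +
      (orb_euler (H\<lparr>carrier := K\<rparr>) \<circ> burnside_red H K) b) :: rat)"
    using ab by (simp add: of_int_orb_euler_red[OF _ K] burnside_add_closed burnside_val_add)
  then show "(orb_euler (H\<lparr>carrier := K\<rparr>) \<circ> burnside_red H K) (a \<otimes>\<^bsub>add_monoid (burnside_ring H)\<^esub> b) =
    (orb_euler (H\<lparr>carrier := K\<rparr>) \<circ> burnside_red H K) a \<otimes>\<^bsub>integer_group\<^esub>
      (orb_euler (H\<lparr>carrier := K\<rparr>) \<circ> burnside_red H K) b"
    by (simp only: of_int_eq_iff mult_integer_group)
qed simp

text \<open>Writing k, g, h, i for the orders of K, G, H and K \<inter> G, the dual of G has order h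
  / g and the intersection of the duals has order h i / (k g). Hence the left side is k^2 / h times
  (h i / (k g))^2 times g / h, which is i^2 / g.\<close>

lemma euler_weight_dual:
  assumes K: "subgroup K H" and G: "subgroup G H"
  shows "euler_weight H K * euler_weight ((character_group H)\<lparr>carrier := dual_subgroup H G\<rparr>)
      (dual_subgroup H K \<inter> dual_subgroup H G) = euler_weight (H\<lparr>carrier := G\<rparr>) (K \<inter> G)"
proof -
  define k g h i d e :: rat where "k = of_nat (card K)" and "g = of_nat (card G)" and "h = of_nat (order H)"
    and "i = of_nat (card (K \<inter> G))" and "d = of_nat (card (dual_subgroup H G))"
    and "e = of_nat (card (dual_subgroup H K \<inter> dual_subgroup H G))"
  have pos: "k > 0" "g > 0" "h > 0"
    using card_subgroup_pos K G order_pos by (auto simp: k_def g_def h_def)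
  have d: "d = h / g"
    using card_dual_subgroup[OF G] pos unfolding d_def g_def h_def
    by (simp add: field_simps flip: of_nat_mult)
  have "e * (k * g) = h * i"
    using card_dual_subgroup_Int[OF K G] unfolding e_def k_def g_def h_def i_def
    by (simp flip: of_nat_mult)
  then have e: "e = h * i / (k * g)" using pos by (simp add: field_simps)
  have "k\<^sup>2 / h * (e\<^sup>2 / d) = i\<^sup>2 / g"
    using pos by (simp add: d e power2_eq_square field_simps)
  then show ?thesis
    by (simp add: euler_weight_def order_def d_def e_def g_def h_def i_def k_def)
qed

end

theorem theorem1:
  fixes \<G> :: "('g, 'm) monoid_scheme" and G :: "'g set"
  assumes "comm_group \<G>" and "finite (carrier \<G>)" and "subgroup G \<G>"
  shows "orb_euler (\<G>\<lparr>carrier := G\<rparr>) \<circ> burnside_red \<G> G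
           \<in> hom (add_monoid (burnside_ring \<G>)) integer_group
       \<and> orb_euler ((character_group \<G>)\<lparr>carrier := dual_subgroup \<G> G\<rparr>)
           \<circ> burnside_red (character_group \<G>) (dual_subgroup \<G> G) \<circ> saito_duality \<G>
           \<in> hom (add_monoid (burnside_ring \<G>)) integer_group
       \<and> (\<forall>a\<in>carrier (burnside_ring \<G>).
            (orb_euler (\<G>\<lparr>carrier := G\<rparr>) \<circ> burnside_red \<G> G) a =
            (orb_euler ((character_group \<G>)\<lparr>carrier := dual_subgroup \<G> G\<rparr>)
               \<circ> burnside_red (character_group \<G>) (dual_subgroup \<G> G) \<circ> saito_duality \<G>) a)"
proof -
  interpret finite_comm_group \<G>
    using assms by (simp add: finite_comm_group_def finite_comm_group_axioms_def)
  interpret C: finite_comm_group "character_group \<G>" by (rule character_group_finite_comm_group)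
  have sub: "subgroup (dual_subgroup \<G> G) (character_group \<G>)"
    by (rule subgroup_dual_subgroup[OF subgroup.subset[OF assms(3)]])
  have D: "saito_duality \<G> \<in> hom (add_monoid (burnside_ring \<G>)) (add_monoid (burnside_ring (character_group \<G>)))"
    using is_saito_hom_saito_duality by (simp add: is_saito_hom_def)
  have "orb_euler (\<G>\<lparr>carrier := G\<rparr>) (burnside_red \<G> G a) =
      orb_euler ((character_group \<G>)\<lparr>carrier := dual_subgroup \<G> G\<rparr>)
        (burnside_red (character_group \<G>) (dual_subgroup \<G> G) (saito_duality \<G> a))"
    if a: "a \<in> carrier (burnside_ring \<G>)" for a
  proof -
    have Da: "saito_duality \<G> a \<in> carrier (burnside_ring (character_group \<G>))"
      using hom_in_carrier[OF D, of a] a by simp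
    \<comment> \<open>In the rationals both sides are values of the functional of \<open>a\<close>,
      so only the two weights remain to be compared, subgroup by subgroup.\<close>
    have "of_int (orb_euler ((character_group \<G>)\<lparr>carrier := dual_subgroup \<G> G\<rparr>)
        (burnside_red (character_group \<G>) (dual_subgroup \<G> G) (saito_duality \<G> a))) =
      (of_int (orb_euler (\<G>\<lparr>carrier := G\<rparr>) (burnside_red \<G> G a)) :: rat)"
      unfolding C.of_int_orb_euler_red[OF Da sub] of_int_orb_euler_red[OF a assms(3)]
        saito_hom_val[OF is_saito_hom_saito_duality a]
      by (rule burnside_val_cong[OF a]) (rule euler_weight_dual[OF _ assms(3)])
    then show ?thesis by simp
  qed
  moreover have "(orb_euler ((character_group \<G>)\<lparr>carrier := dual_subgroup \<G> G\<rparr>)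
           \<circ> burnside_red (character_group \<G>) (dual_subgroup \<G> G)) \<circ> saito_duality \<G>
           \<in> hom (add_monoid (burnside_ring \<G>)) integer_group"
    by (rule Group.hom_compose[OF D C.orb_euler_red_hom[OF sub]])
  ultimately show ?thesis using orb_euler_red_hom[OF assms(3)] by simp
qed

end
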